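(* Let $A, B, C$ be compact sets in $\mathbb{R}$ with $\dim_H(A)+\dim_H(B)+\dim_H(C)>2$. Then: (1) $|(A-B)^2+C|>0$; (2) $|AB+C|>0$; (3) $|A(B+C)|>0$.
   Context: $\dim_H(X)$ denotes the Hausdorff dimension of $X$, and $|X|$ denotes the Lebesgue measure of $X\subset\mathbb{R}$. The sets are images of $A\times B\times C$ under polynomials: $(A-B)^2+C=\{(x-y)^2+z: x\in A, y\in B, z\in C\}$, $AB+C=\{xy+z: x\in A, y\in B, z\in C\}$, $A(B+C)=\{x(y+z): x\in A, y\in B, z\in C\}$. *)

theory Defs
  imports "HOL-Analysis.Analysis"
begin

text \<open>
  The weight \<open>diam(U)\<^sup>s\<close> of a bounded set with the usual conventions: the empty set has
  weight \<open>0\<close> and \<open>diam(U)\<^sup>0 = 1\<close> for nonempty \<open>U\<close>.  The case \<open>s = 0\<close> is separate because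
  \<open>0 powr 0 = 0\<close> in HOL, which would give singletons the wrong weight.
\<close>
definition diam_weight :: "real \<Rightarrow> 'a::metric_space set \<Rightarrow> ennreal" where
  "diam_weight s U =
     (if U = {} then 0 else if s = 0 then 1 else ennreal (diameter U powr s))"

text \<open>
  Boundedness is required since \<open>diameter\<close> is an unspecified value on unbounded sets.
  Empty sets are allowed in a cover, so finite covers are included.
\<close>
definition delta_cover :: "real \<Rightarrow> 'a::metric_space set \<Rightarrow> (nat \<Rightarrow> 'a set) \<Rightarrow> bool" where
  "delta_cover \<delta> X U \<longleftrightarrow>
     X \<subseteq> (\<Union>i. U i) \<and> (\<forall>i. bounded (U i) \<and> diameter (U i) \<le> \<delta>)"

definition hausdorff_premeasure :: "real \<Rightarrow> real \<Rightarrow> 'a::metric_space set \<Rightarrow> ennreal" where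
  "hausdorff_premeasure s \<delta> X = (INF U\<in>{U. delta_cover \<delta> X U}. \<Sum>i. diam_weight s (U i))"

definition hausdorff_measure :: "real \<Rightarrow> 'a::metric_space set \<Rightarrow> ennreal" where
  "hausdorff_measure s X = (SUP \<delta>\<in>{0<..}. hausdorff_premeasure s \<delta> X)"

text \<open>The value is extended real: it is \<open>\<infinity>\<close> if no \<open>s\<close> gives measure zero.\<close>
definition hausdorff_dim :: "'a::metric_space set \<Rightarrow> ereal" where
  "hausdorff_dim X = (INF s\<in>{s. 0 \<le> s \<and> hausdorff_measure s X = 0}. ereal s)"

end

theory Submission
  imports Defs "HOL-Probability.Probability" "HOL-Real_Asymp.Real_Asymp"
begin

text \<open>
  Each of the three polynomials has the form \<open>\<tau>(t) + \<kappa>tu + \<alpha>(u) + \<beta>(u)v\<close> after renaming its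
  variables, with \<open>\<bar>\<beta>\<bar>\<close> bounded below (for \<open>A(B + C)\<close> take \<open>t \<in> B\<close>, \<open>u \<in> A\<close> and discard a
  neighbourhood of \<open>0\<close>).  For fixed \<open>t\<close> this is, up to translation, a projection in a direction given
  by \<open>t\<close> of the planar set of all \<open>(u, \<alpha>(u) + \<beta>(u)v)\<close>.  Let \<open>\<mu>\<close> be the image of a product of
  Frostman measures on that set, of dimension \<open>b + c\<close>, and let \<open>t\<close> be distributed by a Frostman
  measure of dimension \<open>a\<close>.  Following Falconer's bound for exceptional projections, one estimates
  the mean over \<open>t\<close> of \<open>\<integral> \<bar>F(\<rho>\<kappa>t, \<rho>)\<bar>\<^sup>2 d\<rho>\<close>, where \<open>F\<close> is the Fourier transform of \<open>\<mu>\<close>.  As \<open>\<mu>\<close>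
  has bounded support, \<open>F\<close> is essentially constant at unit scale.  So the block \<open>R \<le> \<rho> \<le> 2R\<close>
  contributes at most a constant times \<open>R\<^sup>-\<^sup>a\<close> times the integral of \<open>\<bar>F\<bar>\<^sup>2\<close> over a disc of radius about
  \<open>R\<close>, and that integral is about \<open>R\<^sup>2\<close> times the \<open>\<mu> \<times> \<mu>\<close>-mass of pairs at distance \<open>1/R\<close>.  The
  total is \<open>R\<close> to the power \<open>2 - a - b - c\<close>, which is summable over dyadic \<open>R\<close>.  Hence some projection
  is spread out at every scale.

  Everything is done with finitely supported measures at scale \<open>2\<^sup>-\<^sup>n\<close> and bounds uniform in
  \<open>n\<close>, which avoids weak limits and Plancherel's theorem; the direction \<open>t\<close> may vary with \<open>n\<close>
  because compactness of the full image set is only used at the end.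
\<close>

section \<open>Discrete Frostman measures\<close>

lemma div_two_power_iterate:
  fixes c :: "nat \<Rightarrow> 'a \<Rightarrow> int"
  assumes "\<And>l x. c l x = c (Suc l) x div 2"
  shows "c j x = c (j + d) x div 2 ^ d"
proof (induction d)
  case (Suc d)
  have "c j x = (c (Suc (j + d)) x div 2) div 2 ^ d"
    using Suc assms[of "j + d" x] by simp
  then show ?case
    by (simp add: div_mult2_eq[symmetric] zdiv_zmult2_eq mult.commute)
qed simp

text \<open>
  Max-flow min-cut on a binary tree: masses are pushed up from the leaves and scaled down wherever
  they exceed the capacity \<open>w\<close> of a node; the saturated nodes \<open>xs\<close> form the cut.
\<close>
lemma tree_flow:
  fixes c :: "nat \<Rightarrow> 'a \<Rightarrow> int" and w :: "nat \<Rightarrow> real" and A :: "'a set"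
  assumes c: "\<And>l x. c l x = c (Suc l) x div 2" and w: "\<And>l. 0 < w l"
  shows "\<exists>P p xs. finite P \<and> P \<subseteq> {x \<in> A. c j x = i} \<and> (\<forall>x. 0 \<le> p x) \<and>
    (\<forall>l i'. j \<le> l \<longrightarrow> l \<le> j + k \<longrightarrow> sum p {x \<in> P. c l x = i'} \<le> w l) \<and>
    {x \<in> A. c j x = i} \<subseteq> (\<Union>(l, i') \<in> set xs. {x. c l x = i'}) \<and>
    (\<Sum>(l, i') \<leftarrow> xs. w l) \<le> sum p P"
proof (induction k arbitrary: j i)
  case 0
  show ?case
  proof (cases "{x \<in> A. c j x = i} = {}")
    case True
    then show ?thesis
      using w by (intro exI[of _ "{}"] exI[of _ "\<lambda>_. 0"] exI[of _ "[]"]) (auto simp: less_imp_le)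
  next
    case False
    then obtain x where x: "x \<in> A" "c j x = i" by auto
    \<comment> \<open>A nonempty cell at the bottom level puts its full capacity on a single point
      and is its own cut.\<close>
    have "sum (\<lambda>_. w j) {y \<in> {x}. c l y = i'} \<le> w l" if "j \<le> l" "l \<le> j + 0" for l i'
    proof -
      have "{y \<in> {x}. c l y = i'} = (if c l x = i' then {x} else {})" by auto
      then show ?thesis using that w[of l] by auto
    qed
    then show ?thesis using x w[of j]
      by (intro exI[of _ "{x}"] exI[of _ "\<lambda>_. w j"] exI[of _ "[(j, i)]"]) auto
  qed
next
  case (Suc k)
  obtain P1 p1 xs1 where 1: "finite P1" "P1 \<subseteq> {x \<in> A. c (Suc j) x = 2 * i}" "\<forall>x. 0 \<le> p1 x"
    "\<forall>l i'. Suc j \<le> l \<longrightarrow> l \<le> Suc j + k \<longrightarrow> sum p1 {x \<in> P1. c l x = i'} \<le> w l"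
    "{x \<in> A. c (Suc j) x = 2 * i} \<subseteq> (\<Union>(l, i') \<in> set xs1. {x. c l x = i'})"
    "(\<Sum>(l, i') \<leftarrow> xs1. w l) \<le> sum p1 P1"
    using Suc.IH[of "Suc j" "2 * i"] by blast
  obtain P2 p2 xs2 where 2: "finite P2" "P2 \<subseteq> {x \<in> A. c (Suc j) x = 2 * i + 1}" "\<forall>x. 0 \<le> p2 x"
    "\<forall>l i'. Suc j \<le> l \<longrightarrow> l \<le> Suc j + k \<longrightarrow> sum p2 {x \<in> P2. c l x = i'} \<le> w l"
    "{x \<in> A. c (Suc j) x = 2 * i + 1} \<subseteq> (\<Union>(l, i') \<in> set xs2. {x. c l x = i'})"
    "(\<Sum>(l, i') \<leftarrow> xs2. w l) \<le> sum p2 P2"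
    using Suc.IH[of "Suc j" "2 * i + 1"] by blast
  define P where "P = P1 \<union> P2"
  define p where "p = (\<lambda>x. if x \<in> P1 then p1 x else p2 x)"
  have disj: "P1 \<inter> P2 = {}" using 1(2) 2(2) by fastforce
  have finP: "finite P" using 1 2 by (simp add: P_def)
  have nonneg: "0 \<le> p x" for x using 1(3) 2(3) by (simp add: p_def)
  have split: "sum p {x \<in> P. Q x} = sum p1 {x \<in> P1. Q x} + sum p2 {x \<in> P2. Q x}" for Q
  proof -
    have "{x \<in> P. Q x} = {x \<in> P1. Q x} \<union> {x \<in> P2. Q x}" by (auto simp: P_def)
    then have "sum p {x \<in> P. Q x} = sum p {x \<in> P1. Q x} + sum p {x \<in> P2. Q x}"
      using 1(1) 2(1) disj by (simp, intro sum.union_disjoint) auto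
    moreover have "sum p {x \<in> P1. Q x} = sum p1 {x \<in> P1. Q x}" "sum p {x \<in> P2. Q x} = sum p2 {x \<in> P2. Q x}"
      using disj by (auto simp: p_def intro!: sum.cong)
    ultimately show ?thesis by simp
  qed
  have tot: "sum p P = sum p1 P1 + sum p2 P2" using split[of "\<lambda>_. True"] by simp
  have child: "c j x = i \<longleftrightarrow> c (Suc j) x = 2 * i \<or> c (Suc j) x = 2 * i + 1" for x
    using c[of j x] by auto
  have sub: "P \<subseteq> {x \<in> A. c j x = i}" using 1(2) 2(2) by (auto simp: P_def child)
  have lev: "sum p {x \<in> P. c l x = i'} \<le> w l" if l: "Suc j \<le> l" "l \<le> Suc j + k" for l i'
  proof -
    \<comment> \<open>A node at level \<open>l\<close> determines its ancestor at level
      \<open>Suc j\<close>, so it lies below only one of the two children and sees only one of the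
      two masses.\<close>
    have anc: "c (Suc j) x = i' div 2 ^ (l - Suc j)" if "c l x = i'" for x
      using div_two_power_iterate[of c "Suc j" x "l - Suc j", OF c] l that by simp
    have "{x \<in> P1. c l x = i'} = {} \<or> {x \<in> P2. c l x = i'} = {}"
      using anc 1(2) 2(2) by fastforce
    then show ?thesis
    proof
      assume "{x \<in> P1. c l x = i'} = {}"
      then show ?thesis using 2(4)[rule_format, OF l, of i'] split[of "\<lambda>x. c l x = i'"] by (metis (no_types, lifting) add_0 sum.empty)
    next
      assume "{x \<in> P2. c l x = i'} = {}"
      then show ?thesis using 1(4)[rule_format, OF l, of i'] split[of "\<lambda>x. c l x = i'"] by (metis (no_types, lifting) add_0_right sum.empty)
    qed
  qed
  have root: "sum q {x \<in> P. c j x = i'} \<le> w j" if "sum q P \<le> w j" "\<And>x. 0 \<le> q x" for q i'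
    using that sum_mono2[OF finP, of "{x \<in> P. c j x = i'}" q] by fastforce
  show ?case
  \<comment> \<open>If the root can carry the merged flow, the two cuts are joined. Otherwise the
    flow is scaled down to \<open>w j\<close>, and the saturated root alone is the new cut.\<close>
  proof (cases "sum p P \<le> w j")
    case True
    have "sum p {x \<in> P. c l x = i'} \<le> w l" if l: "j \<le> l" "l \<le> j + Suc k" for l i'
      using lev[of l i'] root[OF True nonneg] l by (cases "l = j") auto
    moreover have "{x \<in> A. c j x = i} \<subseteq> (\<Union>(l, i') \<in> set (xs1 @ xs2). {x. c l x = i'})"
      using 1(5) 2(5) child by fastforce
    moreover have "(\<Sum>(l, i') \<leftarrow> xs1 @ xs2. w l) \<le> sum p P"
      using 1(6) 2(6) tot by simp
    ultimately show ?thesis using finP sub nonneg by blast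
  next
    case False
    define r where "r = w j / sum p P"
    have r: "0 \<le> r" "r \<le> 1" "r * sum p P = w j"
      using False w[of j] by (auto simp: r_def field_simps)
    define q where "q = (\<lambda>x. r * p x)"
    have q: "0 \<le> q x" "q x \<le> p x" for x
      using r nonneg[of x] by (auto simp: q_def mult_left_le_one_le)
    have qP: "sum q P = w j" using r by (simp add: q_def sum_distrib_left[symmetric])
    have "sum q {x \<in> P. c l x = i'} \<le> w l" if l: "j \<le> l" "l \<le> j + Suc k" for l i'
    proof (cases "l = j")
      case True
      then show ?thesis using root[of q i'] qP q by simp
    next
      case False
      then show ?thesis using lev[of l i'] l sum_mono[of "{x \<in> P. c l x = i'}" q p] q by fastforce
    qed
    moreover have "{x \<in> A. c j x = i} \<subseteq> (\<Union>(l, i') \<in> set [(j, i)]. {x. c l x = i'})" by auto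
    moreover have "(\<Sum>(l, i') \<leftarrow> [(j, i)]. w l) \<le> sum q P" using qP by simp
    ultimately show ?thesis using finP sub q by blast
  qed
qed

text \<open>
  Discrete substitute for a Frostman measure: a finitely supported probability measure which obeys
  the Frostman condition only down to scale \<open>2\<^sup>-\<^sup>n\<close>.  The constant must not depend on \<open>n\<close>.
\<close>
definition frostman_weights :: "real \<Rightarrow> real \<Rightarrow> nat \<Rightarrow> real set \<Rightarrow> (real \<Rightarrow> real) \<Rightarrow> bool" where
  "frostman_weights K a n P p \<longleftrightarrow> finite P \<and> (\<forall>x\<in>P. 0 \<le> p x) \<and> sum p P = 1 \<and>
     (\<forall>x r. (1/2) ^ n \<le> r \<longrightarrow> r \<le> 1 \<longrightarrow> sum p (P \<inter> {x..x + r}) \<le> K * r powr a)"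

definition frostman :: "real \<Rightarrow> real \<Rightarrow> real set \<Rightarrow> bool" where
  "frostman K a A \<longleftrightarrow> (\<forall>n. \<exists>P p. P \<subseteq> A \<and> frostman_weights K a n P p)"

lemma frostman_weightsD:
  assumes "frostman_weights K a n P p"
  shows "finite P" "\<And>x. x \<in> P \<Longrightarrow> 0 \<le> p x" "sum p P = 1"
    "\<And>x r. (1/2) ^ n \<le> r \<Longrightarrow> r \<le> 1 \<Longrightarrow> sum p (P \<inter> {x..x + r}) \<le> K * r powr a"
  using assms by (auto simp: frostman_weights_def)

section \<open>From positive Hausdorff measure to Frostman weights\<close>

lemma hausdorff_premeasure_le_finite_cover:
  fixes cell :: "nat \<Rightarrow> 'a::metric_space set"
  assumes a: "0 < a" and X: "X \<subseteq> (\<Union>k<N. cell k)"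
    and bd: "\<And>k. k < N \<Longrightarrow> bounded (cell k)"
    and d: "\<And>k. k < N \<Longrightarrow> diameter (cell k) \<le> d k" "\<And>k. k < N \<Longrightarrow> d k \<le> \<delta>"
    and \<delta>: "0 \<le> \<delta>"
  shows "hausdorff_premeasure a \<delta> X \<le> ennreal (\<Sum>k<N. d k powr a)"
proof -
  \<comment> \<open>Padding with the empty set, of weight \<open>0\<close>, turns the finite family
    into a sequence without changing the sum.\<close>
  define U where "U = (\<lambda>k. if k < N then cell k else {})"
  have "delta_cover \<delta> X U"
    using X bd d \<delta> unfolding delta_cover_def U_def by (fastforce simp: intro: order_trans)
  then have "hausdorff_premeasure a \<delta> X \<le> (\<Sum>k. diam_weight a (U k))"
    unfolding hausdorff_premeasure_def by (intro INF_lower) simp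
  also have "\<dots> = (\<Sum>k<N. diam_weight a (U k))"
    by (intro suminf_finite) (auto simp: U_def diam_weight_def)
  also have "\<dots> \<le> (\<Sum>k<N. ennreal (d k powr a))"
  proof (intro sum_mono)
    fix k assume "k \<in> {..<N}"
    then have "diameter (cell k) powr a \<le> d k powr a"
      using d bd a diameter_ge_0 by (intro powr_mono2) auto
    then show "diam_weight a (U k) \<le> ennreal (d k powr a)"
      using a by (auto simp: diam_weight_def U_def ennreal_leI)
  qed
  also have "\<dots> = ennreal (\<Sum>k<N. d k powr a)" by simp
  finally show ?thesis .
qed

text \<open>Some premeasure at a scale \<open>\<delta>\<close> is positive, which bounds the cost of
  every cover by cells of length at most \<open>\<delta>\<close> from below. A cover that uses a
  longer cell already pays at least \<open>(\<delta> / L) powr a\<close> for that cell. Covers with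
  cells of unrestricted size are what a cut in \<open>tree_flow\<close> produces.\<close>

lemma dyadic_cover_lower_bound:
  fixes A :: "real set"
  assumes a: "0 < a" and L: "0 < L" and pos: "hausdorff_measure a A \<noteq> 0"
  obtains c where "0 < c"
    "\<And>xs. A \<subseteq> (\<Union>(l, i) \<in> set xs. {x. \<lfloor>(x - x0) / L * 2 ^ l\<rfloor> = i}) \<Longrightarrow>
      c \<le> (\<Sum>(l, i) \<leftarrow> xs. ((1/2) ^ l) powr a)"
proof -
  obtain \<delta> where \<delta>: "0 < \<delta>" "hausdorff_premeasure a \<delta> A \<noteq> 0"
    using pos unfolding hausdorff_measure_def
    by (metis (no_types, lifting) SUP_bot_conv(2) bot_ennreal greaterThan_iff)
  obtain e where e: "0 < e" "ennreal e \<le> hausdorff_premeasure a \<delta> A"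
  proof (cases "hausdorff_premeasure a \<delta> A" rule: ennreal_cases)
    case (real r)
    then have "0 < r" using \<delta>(2) by (cases "r = 0") auto
    then show ?thesis using that[of r] real by simp
  next
    case top
    then show ?thesis using that[of 1] by simp
  qed
  define c where "c = min (e / L powr a) ((\<delta> / L) powr a)"
  have "0 < c" using e \<delta> L by (simp add: c_def)
  moreover have "c \<le> (\<Sum>(l, i) \<leftarrow> xs. ((1/2) ^ l) powr a)"
    if cov: "A \<subseteq> (\<Union>(l, i) \<in> set xs. {x. \<lfloor>(x - x0) / L * 2 ^ l\<rfloor> = i})" for xs
  proof -
    have sum: "(\<Sum>(l, i) \<leftarrow> xs. ((1/2) ^ l) powr a) = (\<Sum>k<length xs. ((1/2) ^ fst (xs ! k)) powr a)"
      by (subst sum_list_sum_nth) (simp add: case_prod_beta atLeast0LessThan)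
    show ?thesis
    proof (cases "\<forall>k<length xs. L * (1/2) ^ fst (xs ! k) \<le> \<delta>")
      case True
      \<comment> \<open>Closing the half-open floor cells keeps their length and makes their
        diameter immediate.\<close>
      define cell where "cell = (\<lambda>k. {x0 + L * snd (xs ! k) * (1/2) ^ fst (xs ! k) ..
         x0 + L * snd (xs ! k) * (1/2) ^ fst (xs ! k) + L * (1/2) ^ fst (xs ! k)})"
      have "A \<subseteq> (\<Union>k<length xs. cell k)"
      proof
        fix x assume "x \<in> A"
        then obtain l i where li: "(l, i) \<in> set xs" "\<lfloor>(x - x0) / L * 2 ^ l\<rfloor> = i" using cov by auto
        then obtain k where k: "k < length xs" "xs ! k = (l, i)" by (auto simp: in_set_conv_nth)
        have "of_int i \<le> (x - x0) / L * 2 ^ l" "(x - x0) / L * 2 ^ l \<le> of_int i + 1"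
          using li(2) by linarith+
        then have "x \<in> cell k" using L k by (simp add: cell_def field_simps power_divide)
        then show "x \<in> (\<Union>k<length xs. cell k)" using k by auto
      qed
      then have "hausdorff_premeasure a \<delta> A \<le> ennreal (\<Sum>k<length xs. (L * (1/2) ^ fst (xs ! k)) powr a)"
        using a True \<delta> L by (intro hausdorff_premeasure_le_finite_cover) (auto simp: cell_def)
      then have "ennreal e \<le> ennreal (\<Sum>k<length xs. (L * (1/2) ^ fst (xs ! k)) powr a)"
        using e(2) by (rule order_trans[rotated])
      then have "e \<le> (\<Sum>k<length xs. (L * (1/2) ^ fst (xs ! k)) powr a)"
        by (subst (asm) ennreal_le_iff) (auto intro: sum_nonneg)
      also have "\<dots> = L powr a * (\<Sum>k<length xs. ((1/2) ^ fst (xs ! k)) powr a)"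
        using L by (simp add: powr_mult sum_distrib_left)
      finally have "e / L powr a \<le> (\<Sum>k<length xs. ((1/2) ^ fst (xs ! k)) powr a)"
        using L by (simp add: field_simps)
      then show ?thesis unfolding sum c_def by linarith
    next
      case False
      then obtain k where k: "k < length xs" "\<delta> < L * (1/2) ^ fst (xs ! k)" by auto
      have "(\<delta> / L) powr a \<le> ((1/2) ^ fst (xs ! k)) powr a"
        using k L \<delta> a by (intro powr_mono2) (auto simp: field_simps)
      also have "\<dots> \<le> (\<Sum>k<length xs. ((1/2) ^ fst (xs ! k)) powr a)"
        using k by (intro member_le_sum) auto
      finally show ?thesis unfolding sum c_def by linarith
    qed
  qed
  ultimately show ?thesis using that by blast
qed

text \<open>The flow with capacities \<open>((1/2) ^ l) powr a\<close> on dyadic cells has a cut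
  that covers \<open>A\<close>, so its mass is at least the lower bound \<open>\<gamma>\<close> for
  covers. Normalising it therefore costs at most a factor \<open>1 / \<gamma>\<close>, which does
  not depend on \<open>n\<close>.\<close>

lemma frostman_exists:
  fixes A :: "real set"
  assumes bd: "bounded A" and a: "0 < a" and pos: "hausdorff_measure a A \<noteq> 0"
  obtains K where "frostman K a A"
proof -
  obtain M where M: "0 < M" "\<And>x. x \<in> A \<Longrightarrow> \<bar>x\<bar> \<le> M"
    using bd by (auto simp: bounded_pos)
  \<comment> \<open>The extra \<open>1\<close> makes the interval longer than \<open>2 * M\<close>,
    so that even the point \<open>M\<close> falls into the root cell \<open>0\<close>.\<close>
  define L where "L = 2 * M + 1"
  have L: "0 < L" using M by (simp add: L_def)
  define w :: "nat \<Rightarrow> real" where "w = (\<lambda>l. ((1/2) ^ l) powr a)"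
  define c :: "nat \<Rightarrow> real \<Rightarrow> int" where "c = (\<lambda>l x. \<lfloor>(x - (-M)) / L * 2 ^ l\<rfloor>)"
  have c: "c l x = c (Suc l) x div 2" for l x
    using floor_divide_real_eq_div[of 2 "(x - (-M)) / L * 2 ^ Suc l"] by (simp add: c_def)
  have w: "0 < w l" for l by (simp add: w_def)
  have c0: "c 0 x = 0" if "x \<in> A" for x
    using M(2)[OF that] M(1) by (auto simp: c_def L_def floor_eq_iff field_simps)
  obtain \<gamma> where \<gamma>: "0 < \<gamma>"
    "\<And>xs. A \<subseteq> (\<Union>(l, i) \<in> set xs. {x. c l x = i}) \<Longrightarrow> \<gamma> \<le> (\<Sum>(l, i) \<leftarrow> xs. w l)"
    using dyadic_cover_lower_bound[OF a L pos, of "-M"] unfolding c_def w_def by blast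
  define K where "K = 3 * (1 / L) powr a / \<gamma>"
  have "\<exists>P p. P \<subseteq> A \<and> frostman_weights K a n P p" for n
  proof -
    \<comment> \<open>The tree must be deep enough that its smallest cells are no longer than the
      smallest admissible radius.\<close>
    obtain N where N: "L * (1/2) ^ N \<le> (1/2) ^ n"
    proof -
      obtain N where "(1/2::real) ^ N < (1/2) ^ n / L"
        using L real_arch_pow_inv[of "(1/2) ^ n / L" "1/2"] by auto
      then show ?thesis using that[of N] L by (simp add: field_simps)
    qed
    obtain P p xs where P: "finite P" "P \<subseteq> {x \<in> A. c 0 x = 0}" "\<forall>x. 0 \<le> p x"
      "\<forall>l i'. 0 \<le> l \<longrightarrow> l \<le> 0 + N \<longrightarrow> sum p {x \<in> P. c l x = i'} \<le> w l"
      "{x \<in> A. c 0 x = 0} \<subseteq> (\<Union>(l, i') \<in> set xs. {x. c l x = i'})"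
      "(\<Sum>(l, i') \<leftarrow> xs. w l) \<le> sum p P"
      using tree_flow[of c w A 0 0 N, OF c w] by (elim exE conjE) (rule that)
    have S: "\<gamma> \<le> sum p P"
      using \<gamma>(2)[of xs] P(5,6) c0 by fastforce
    have mass: "sum p (P \<inter> {x..x + r}) \<le> 3 * (1 / L) powr a * r powr a"
      if r: "(1/2) ^ n \<le> r" for x r
    proof -
      have r0: "0 < r" using r zero_less_power[of "1/2 :: real" n] by linarith
      \<comment> \<open>At the first level with cells of length at most \<open>r\<close>, the cells
        are longer than \<open>r / 2\<close> unless \<open>l = 0\<close>, so an interval of length
        \<open>r\<close> meets at most three of them. For \<open>l = 0\<close> the capacity of the
        root suffices.\<close>
      define l where "l = (LEAST l. L * (1/2) ^ l \<le> r)"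
      have l: "L * (1/2) ^ l \<le> r" unfolding l_def by (rule LeastI[of _ N]) (use N r in simp)
      have lN: "l \<le> N" unfolding l_def by (rule Least_le) (use N r in simp)
      have wl: "w l \<le> (1 / L) powr a * r powr a"
      proof -
        have "w l \<le> (r / L) powr a"
          unfolding w_def using l L a by (intro powr_mono2) (auto simp: field_simps)
        also have "\<dots> = (1 / L) powr a * r powr a"
          using L r0 by (simp add: powr_mult[symmetric])
        finally show ?thesis .
      qed
      define i where "i = c l x"
      have "P \<inter> {x..x + r} \<subseteq> {y \<in> P. c l y = i} \<union> {y \<in> P. c l y = i + 1} \<union> {y \<in> P. c l y = i + 2}
         \<or> l = 0"
      proof (cases l)
        case (Suc l')
        have "\<not> L * (1/2) ^ l' \<le> r" using not_less_Least[of l' "\<lambda>l. L * (1/2) ^ l \<le> r"] Suc by (simp add: l_def)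
        then have rl: "r / L * 2 ^ l < 2" using L Suc by (simp add: field_simps)
        have "c l y = i \<or> c l y = i + 1 \<or> c l y = i + 2" if y: "y \<in> {x..x + r}" for y
        proof -
          have "(x - (-M)) / L * 2 ^ l \<le> (y - (-M)) / L * 2 ^ l"
            using y L by (intro mult_right_mono divide_right_mono) auto
          moreover have "(y - (-M)) / L * 2 ^ l \<le> (x + r - (-M)) / L * 2 ^ l"
            using y L by (intro mult_right_mono divide_right_mono) auto
          moreover have "(x + r - (-M)) / L * 2 ^ l = (x - (-M)) / L * 2 ^ l + r / L * 2 ^ l"
            by (simp add: add_divide_distrib algebra_simps diff_divide_distrib)
          ultimately show ?thesis using rl unfolding c_def i_def by linarith
        qed
        then show ?thesis by blast
      qed simp
      then show ?thesis
      proof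
        assume sub: "P \<inter> {x..x + r} \<subseteq> {y \<in> P. c l y = i} \<union> {y \<in> P. c l y = i + 1} \<union> {y \<in> P. c l y = i + 2}"
        have "sum p (P \<inter> {x..x + r}) \<le> sum p ({y \<in> P. c l y = i} \<union> {y \<in> P. c l y = i + 1} \<union> {y \<in> P. c l y = i + 2})"
          using sub P(1,3) by (intro sum_mono2) auto
        also have "\<dots> = sum p {y \<in> P. c l y = i} + sum p {y \<in> P. c l y = i + 1} + sum p {y \<in> P. c l y = i + 2}"
          using P(1) by (subst sum.union_disjoint, auto)+
        also have "\<dots> \<le> 3 * w l"
          using P(4)[rule_format, of l i] P(4)[rule_format, of l "i + 1"] P(4)[rule_format, of l "i + 2"] lN by simp
        finally show ?thesis using wl by simp
      next
        assume "l = 0"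
        have "sum p (P \<inter> {x..x + r}) \<le> sum p {y \<in> P. c 0 y = 0}"
          using P(1-3) by (intro sum_mono2) auto
        also have "\<dots> \<le> w 0" using P(4)[rule_format, of 0 0] by simp
        finally show ?thesis using wl \<open>l = 0\<close> w[of 0] by simp
      qed
    qed
    define q where "q = (\<lambda>x. p x / sum p P)"
    have "frostman_weights K a n P q"
      unfolding frostman_weights_def
    proof (intro conjI allI impI ballI)
      show "finite P" by fact
      show "0 \<le> q x" for x using P(3) by (simp add: q_def sum_nonneg)
      show "sum q P = 1" using S \<gamma>(1) by (simp add: q_def sum_divide_distrib[symmetric])
      fix x r :: real assume r: "(1/2) ^ n \<le> r" "r \<le> 1"
      have "sum q (P \<inter> {x..x + r}) = sum p (P \<inter> {x..x + r}) / sum p P"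
        by (simp add: q_def sum_divide_distrib)
      also have "\<dots> \<le> (3 * (1 / L) powr a * r powr a) / \<gamma>"
        using mass[OF r(1)] S \<gamma>(1) P(3) by (intro frac_le) (auto intro: sum_nonneg)
      finally show "sum q (P \<inter> {x..x + r}) \<le> K * r powr a" by (simp add: K_def)
    qed
    then show ?thesis using P(2) by blast
  qed
  then show ?thesis using that unfolding frostman_def by blast
qed

text \<open>A cover of \<open>{-M..M}\<close> by \<open>N\<close> equal intervals costs
  \<open>N * (2 * M / N) powr s\<close>, which tends to \<open>0\<close> because
  \<open>s > 1\<close>.\<close>

lemma hausdorff_measure_eq_0_above_1:
  fixes A :: "real set"
  assumes bd: "bounded A" and s: "1 < s"
  shows "hausdorff_measure s A = 0"
proof -
  obtain M where M: "0 < M" "\<And>x. x \<in> A \<Longrightarrow> \<bar>x\<bar> \<le> M"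
    using bd by (auto simp: bounded_pos)
  have "hausdorff_premeasure s \<delta> A \<le> 0" if \<delta>: "0 < \<delta>" for \<delta>
  proof (rule tendsto_lowerbound)
    have "(\<lambda>N::nat. real N * (2 * M / real N) powr s) \<longlonglongrightarrow> 0"
      using s M(1) by real_asymp
    then show "(\<lambda>N::nat. ennreal (real N * (2 * M / real N) powr s)) \<longlonglongrightarrow> 0"
      using tendsto_ennrealI by fastforce
    have "\<forall>\<^sub>F N::nat in sequentially. 2 * M / real N \<le> \<delta>" 
      using \<delta> M(1) by real_asymp
    then show "\<forall>\<^sub>F N::nat in sequentially. hausdorff_premeasure s \<delta> A \<le> ennreal (real N * (2 * M / real N) powr s)"
      using eventually_gt_at_top[of 0]
    proof eventually_elim
      case (elim N)
      define cell where "cell = (\<lambda>k::nat. {-M + real k * (2 * M / N) .. -M + real k * (2 * M / N) + 2 * M / N})"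
      have "A \<subseteq> (\<Union>k<N. cell k)"
      proof
        fix x assume x: "x \<in> A"
        define k where "k = nat \<lfloor>(x + M) / (2 * M / N)\<rfloor>"
        have nn: "0 \<le> (x + M) / (2 * M / N)" using M(1) M(2)[OF x] elim by auto
        show "x \<in> (\<Union>k<N. cell k)"
        \<comment> \<open>The right endpoint would get the index \<open>N\<close> and is assigned to
          the last interval instead.\<close>
        proof (cases "x = M")
          case True
          then have "x \<in> cell (N - 1)" using elim M(1) by (auto simp: cell_def field_simps of_nat_diff)
          then show ?thesis using elim by auto
        next
          case False
          have "(x + M) / (2 * M / N) < N" using False M(1) M(2)[OF x] elim by (auto simp: field_simps)
          then have "k < N" using nn elim by (simp add: k_def nat_less_iff floor_less_iff)
          moreover have k: "real k \<le> (x + M) / (2 * M / N)" "(x + M) / (2 * M / N) < real k + 1"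
            using nn unfolding k_def by linarith+
          have "x \<in> cell k" using k M(1) elim by (auto simp: cell_def field_simps)
          ultimately show ?thesis by auto
        qed
      qed
      then have "hausdorff_premeasure s \<delta> A \<le> ennreal (\<Sum>k<N. (2 * M / N) powr s)"
        using elim M(1) s \<delta> by (intro hausdorff_premeasure_le_finite_cover) (auto simp: cell_def)
      then show ?case by simp
    qed
  qed simp
  then have "hausdorff_measure s A \<le> 0"
    unfolding hausdorff_measure_def by (intro SUP_least) simp
  then show ?thesis by simp
qed

lemma hausdorff_dim_le_1:
  fixes A :: "real set"
  assumes "bounded A"
  shows "hausdorff_dim A \<le> 1"
proof (rule ccontr)
  assume "\<not> hausdorff_dim A \<le> 1"
  then obtain s where s: "1 < ereal s" "ereal s < hausdorff_dim A"
    using ereal_dense2[of 1 "hausdorff_dim A"] by (auto simp: not_le)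
  then have "hausdorff_dim A \<le> ereal s"
    unfolding hausdorff_dim_def
    using hausdorff_measure_eq_0_above_1[OF assms, of s] by (intro INF_lower) (auto simp: one_ereal_def)
  then show False using s by simp
qed

lemma frostman_exists_below_dim:
  fixes A :: "real set"
  assumes "bounded A" "0 < a" "ereal a < hausdorff_dim A"
  obtains K where "frostman K a A"
proof -
  have "hausdorff_measure a A \<noteq> 0"
  proof
    assume "hausdorff_measure a A = 0"
    then have "hausdorff_dim A \<le> ereal a"
      unfolding hausdorff_dim_def using assms(2) by (intro INF_lower) auto
    then show False using assms(3) by simp
  qed
  then show ?thesis using frostman_exists[OF assms(1,2)] that by blast
qed

section \<open>Restriction and Gaussian sums of Frostman weights\<close>

lemma frostman_weights_const_nonneg:
  assumes "frostman_weights K a n P p"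
  shows "0 \<le> K"
proof -
  have "0 \<le> sum p (P \<inter> {0..0 + 1})" using frostman_weightsD(2)[OF assms] by (intro sum_nonneg) auto
  also have "\<dots> \<le> K * 1 powr a" using assms by (intro frostman_weightsD(4)) (auto simp: power_le_one)
  finally show ?thesis by simp
qed

text \<open>By the Frostman condition a short interval around \<open>0\<close> has mass at most
  \<open>1/2\<close>; cutting it off and renormalising at most doubles the constant. This supplies
  the lower bound on the factor \<open>x\<close> in \<open>x * (y + z)\<close>.\<close>

lemma frostman_away_from_0:
  assumes F: "frostman K a A" and a: "0 < a"
  obtains m where "0 < m" "m \<le> 1" "frostman (2 * K) a {x \<in> A. m \<le> \<bar>x\<bar>}"
proof -
  have "(\<lambda>j::nat. K * ((1/2) ^ j) powr a) \<longlonglongrightarrow> 0"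
    using a by real_asymp
  then have "\<forall>\<^sub>F j::nat in sequentially. K * ((1/2) ^ j) powr a < 1/2"
    by (rule order_tendstoD) simp
  then obtain j :: nat where j: "K * ((1/2) ^ j) powr a < 1/2"
    by (auto simp: eventually_at_top_linorder)
  define m :: real where "m = (1/2) ^ j / 2"
  have m: "0 < m" "m \<le> 1" using power_le_one[of "1/2::real" j] by (auto simp: m_def)
  have "\<exists>Q q. Q \<subseteq> {x \<in> A. m \<le> \<bar>x\<bar>} \<and> frostman_weights (2 * K) a n Q q" for n
  proof -
    \<comment> \<open>Depth \<open>max n j\<close> makes the condition applicable to
      \<open>{-m..m}\<close>, of length \<open>(1/2) ^ j\<close>, even when
      \<open>n < j\<close>.\<close>
    obtain P p where P: "P \<subseteq> A" "frostman_weights K a (max n j) P p"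
      using F unfolding frostman_def by blast
    note D = frostman_weightsD[OF P(2)]
    define Q where "Q = {x \<in> P. m \<le> \<bar>x\<bar>}"
    have "sum p (P \<inter> {-m..-m + 2 * m}) \<le> K * (2 * m) powr a"
      using m by (intro D(4)) (auto simp: m_def power_le_one intro!: power_decreasing)
    then have near: "sum p (P \<inter> {-m..-m + 2 * m}) \<le> 1/2" using j by (simp add: m_def)
    have "1 \<le> sum p (Q \<union> (P \<inter> {-m..-m + 2 * m}))"
      unfolding D(3)[symmetric] using D(1,2) by (intro sum_mono2) (auto simp: Q_def)
    also have "\<dots> \<le> sum p Q + sum p (P \<inter> {-m..-m + 2 * m})"
      using D(1,2) by (subst sum.union_inter[symmetric]) (auto simp: Q_def intro!: sum_nonneg)
    finally have half: "1/2 \<le> sum p Q" using near by simp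
    define q where "q = (\<lambda>x. p x / sum p Q)"
    have "frostman_weights (2 * K) a n Q q"
      unfolding frostman_weights_def
    proof (intro conjI allI impI ballI)
      show "finite Q" using D(1) by (simp add: Q_def)
      show "0 \<le> q x" if "x \<in> Q" for x using that D(2) half by (simp add: q_def Q_def)
      show "sum q Q = 1" using half by (simp add: q_def sum_divide_distrib[symmetric])
      fix x r :: real assume r: "(1/2) ^ n \<le> r" "r \<le> 1"
      have "(1/2::real) ^ max n j \<le> (1/2) ^ n" by (intro power_decreasing) auto
      then have *: "sum p (P \<inter> {x..x + r}) \<le> K * r powr a" using r by (intro D(4)) linarith+
      have "sum q (Q \<inter> {x..x + r}) = sum p (Q \<inter> {x..x + r}) / sum p Q"
        by (simp add: q_def sum_divide_distrib)
      also have "\<dots> \<le> sum p (P \<inter> {x..x + r}) / (1/2)"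
        using half D(1,2) by (intro frac_le sum_nonneg sum_mono2) (auto simp: Q_def)
      finally show "sum q (Q \<inter> {x..x + r}) \<le> 2 * K * r powr a" using * by simp
    qed
    moreover have "Q \<subseteq> {x \<in> A. m \<le> \<bar>x\<bar>}" using P(1) by (auto simp: Q_def)
    ultimately show ?thesis by (intro exI conjI)
  qed
  then show ?thesis using that[OF m] unfolding frostman_def by blast
qed

text \<open>The points are sorted into shells by the integer part \<open>m\<close> of
  \<open>R * \<bar>x - y\<bar>\<close>. A shell lies in two intervals of length
  \<open>1 / R\<close>, hence has mass at most \<open>2 * K * R powr - a\<close>, while the Gaussian
  is at most \<open>(1/2) ^ m\<close> on it. The geometric series contributes the remaining factor
  \<open>2\<close>.\<close>

lemma frostman_weights_gaussian_sum:
  assumes F: "frostman_weights K a n P p" and a: "0 < a" and R: "0 < R" "R \<le> 2 ^ n"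
  shows "(\<Sum>x\<in>P. p x * exp (- (R * (x - y))\<^sup>2)) \<le> (4 * K + 1) * R powr - a"
\<comment> \<open>Here \<open>1 / R\<close> exceeds the largest radius covered by the Frostman
  condition, but the total mass \<open>1\<close> is enough and accounts for the \<open>+ 1\<close>
  in the constant. Such values occur later as \<open>m * R\<close> with small
  \<open>m\<close>.\<close>
proof (cases "R < 1")
  case True
  note D = frostman_weightsD[OF F]
  have "(\<Sum>x\<in>P. p x * exp (- (R * (x - y))\<^sup>2)) \<le> (\<Sum>x\<in>P. p x * 1)"
    using D(2) by (intro sum_mono mult_left_mono) auto
  also have "\<dots> = 1" using D(3) by simp
  also have "1 \<le> R powr - a" using True R(1) a by (simp add: powr_minus powr_le1 one_le_inverse)
  also have "\<dots> \<le> (4 * K + 1) * R powr - a"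
    using frostman_weights_const_nonneg[OF F] by (simp add: algebra_simps)
  finally show ?thesis .
next
  case False
  then have R1: "1 \<le> R" by simp
  note D = frostman_weightsD[OF F]
  define l where "l = (\<lambda>x. nat \<lfloor>R * \<bar>x - y\<bar>\<rfloor>)"
  have lev: "(\<Sum>x | x \<in> P \<and> l x = m. p x * exp (- (R * (x - y))\<^sup>2)) \<le> (1/2) ^ m * (2 * K * R powr - a)" for m
  proof -
    have lm: "real m \<le> R * \<bar>x - y\<bar>" "R * \<bar>x - y\<bar> \<le> real m + 1" if "l x = m" for x
    proof -
      have "0 \<le> R * \<bar>x - y\<bar>" using R by simp
      then show "real m \<le> R * \<bar>x - y\<bar>" "R * \<bar>x - y\<bar> \<le> real m + 1" using that unfolding l_def by linarith+
    qed
    have e: "exp (- (R * (x - y))\<^sup>2) \<le> (1/2) ^ m" if "l x = m" for x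
    proof -
      have "real m \<le> (real m)\<^sup>2" by (cases m) (auto simp: power2_eq_square)
      also have "\<dots> \<le> (R * \<bar>x - y\<bar>)\<^sup>2" using lm(1)[OF that] by (intro power_mono) auto
      also have "\<dots> = (R * (x - y))\<^sup>2" by (simp add: power_mult_distrib)
      finally have "exp (- (R * (x - y))\<^sup>2) \<le> exp (- real m)" by simp
      also have "\<dots> = exp (-1) ^ m" by (simp add: exp_of_nat_mult[symmetric])
      also have "\<dots> \<le> (1/2) ^ m"
      proof (rule power_mono)
        have "2 \<le> exp (1::real)" using exp_ge_add_one_self[of 1] by simp
        then show "exp (-1) \<le> (1/2::real)" by (simp add: exp_minus field_simps)
      qed simp
      finally show ?thesis .
    qed
    have I: "sum p (P \<inter> {z..z + 1 / R}) \<le> K * R powr - a" for z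
    proof -
      have "sum p (P \<inter> {z..z + 1 / R}) \<le> K * (1 / R) powr a"
        using R R1 by (intro D(4)) (auto simp: field_simps)
      moreover have "(1 / R) powr a = R powr - a"
        using R by (subst powr_divide) (auto simp: powr_minus divide_inverse)
      ultimately show ?thesis by simp
    qed
    have "sum p {x \<in> P. l x = m} \<le> sum p ((P \<inter> {y + m / R..y + m / R + 1 / R}) \<union> (P \<inter> {y - (m + 1) / R..y - (m + 1) / R + 1 / R}))"
    proof (intro sum_mono2)
      show "{x \<in> P. l x = m} \<subseteq> (P \<inter> {y + m / R..y + m / R + 1 / R}) \<union> (P \<inter> {y - (m + 1) / R..y - (m + 1) / R + 1 / R})"
      proof
        fix x assume x: "x \<in> {x \<in> P. l x = m}"
        then have "real m \<le> R * \<bar>x - y\<bar>" "R * \<bar>x - y\<bar> \<le> real m + 1" using lm by auto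
        then have "x \<in> {y + m / R..y + m / R + 1 / R} \<or> x \<in> {y - (m + 1) / R..y - (m + 1) / R + 1 / R}"
          using R(1) by (cases "y \<le> x") (auto simp: field_simps)
        then show "x \<in> (P \<inter> {y + m / R..y + m / R + 1 / R}) \<union> (P \<inter> {y - (m + 1) / R..y - (m + 1) / R + 1 / R})"
          using x by blast
      qed
    qed (use D in auto)
    also have "\<dots> \<le> sum p (P \<inter> {y + m / R..y + m / R + 1 / R}) + sum p (P \<inter> {y - (m + 1) / R..y - (m + 1) / R + 1 / R})"
      using D(1,2) by (subst sum.union_inter[symmetric]) (auto intro!: sum_nonneg)
    also have "\<dots> \<le> 2 * K * R powr - a" using I[of "y + m / R"] I[of "y - (m + 1) / R"] by linarith
    finally have mass: "sum p {x \<in> P. l x = m} \<le> 2 * K * R powr - a" .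
    have "(\<Sum>x | x \<in> P \<and> l x = m. p x * exp (- (R * (x - y))\<^sup>2)) \<le> (\<Sum>x | x \<in> P \<and> l x = m. p x * (1/2) ^ m)"
      using e D(2) by (intro sum_mono mult_left_mono) auto
    also have "\<dots> = (1/2) ^ m * sum p {x \<in> P. l x = m}" by (simp add: sum_distrib_left mult.commute)
    also have "\<dots> \<le> (1/2) ^ m * (2 * K * R powr - a)" using mass by (intro mult_left_mono) auto
    finally show ?thesis .
  qed
  have "(\<Sum>x\<in>P. p x * exp (- (R * (x - y))\<^sup>2)) =
     (\<Sum>m\<in>l ` P. \<Sum>x | x \<in> P \<and> l x = m. p x * exp (- (R * (x - y))\<^sup>2))"
    by (rule sum.image_gen[OF D(1)])
  also have "\<dots> \<le> (\<Sum>m\<in>l ` P. (1/2) ^ m * (2 * K * R powr - a))"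
    by (intro sum_mono lev)
  also have "\<dots> = (\<Sum>m\<in>l ` P. (1/2) ^ m) * (2 * K * R powr - a)" by (simp add: sum_distrib_right)
  also have "\<dots> \<le> 2 * (2 * K * R powr - a)"
  proof (rule mult_right_mono)
    have "(\<Sum>m\<in>l ` P. (1/2::real) ^ m) \<le> (\<Sum>m. (1/2) ^ m)"
      using D(1) by (intro sum_le_suminf summable_geometric) auto
    also have "\<dots> = 2" by (subst suminf_geometric) auto
    finally show "(\<Sum>m\<in>l ` P. (1/2::real) ^ m) \<le> 2" .
  qed (use frostman_weights_const_nonneg[OF F] in auto)
  also have "\<dots> \<le> (4 * K + 1) * R powr - a" by (simp add: algebra_simps)
  finally show ?thesis .
qed

section \<open>Exponential sums and Gaussian means\<close>

lemma integral_cis_std_normal: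
  "(CLINT x|std_normal_distribution. cis (x * y)) = complex_of_real (exp (- y\<^sup>2 / 2))"
proof -
  have "char std_normal_distribution y = (CLINT x|std_normal_distribution. cis (x * y))"
    by (simp add: char_def cis_conv_exp mult.commute mult.left_commute)
  then show ?thesis using char_std_normal_distribution by (simp add: fun_eq_iff)
qed

lemma integrable_std_normal_bounded:
  fixes f :: "real \<Rightarrow> 'b::{banach,second_countable_topology}"
  assumes "continuous_on UNIV f" "\<And>x. norm (f x) \<le> B"
  shows "integrable std_normal_distribution f"
proof -
  interpret N: real_distribution std_normal_distribution by (rule real_dist_normal_dist)
  show ?thesis
    using assms borel_measurable_continuous_onI[OF assms(1)]
    by (intro N.integrable_const_bound[of _ B]) auto
qed

lemma cmod_sum_square:
  "complex_of_real ((cmod (\<Sum>i\<in>I. z i))\<^sup>2) = (\<Sum>i\<in>I. \<Sum>j\<in>I. z i * cnj (z j))"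
proof -
  have "complex_of_real ((cmod (\<Sum>i\<in>I. z i))\<^sup>2) = (\<Sum>i\<in>I. z i) * cnj (\<Sum>i\<in>I. z i)"
    by (rule complex_norm_square)
  also have "\<dots> = (\<Sum>i\<in>I. \<Sum>j\<in>I. z i * cnj (z j))"
    unfolding cnj_sum by (rule sum_product)
  finally show ?thesis .
qed

text \<open>This replaces Plancherel: a Gaussian average over frequencies of size about
  \<open>L\<close> turns each oscillating factor into a positive kernel concentrated on pairs at
  distance about \<open>1 / L\<close>.\<close>

lemma gaussian_mean_double_sum:
  fixes c :: "'i \<Rightarrow> 'i \<Rightarrow> complex" and y :: "'i \<Rightarrow> real"
  assumes "finite I"
  shows "(CLINT x|std_normal_distribution. (\<Sum>i\<in>I. \<Sum>j\<in>I. c i j * cis (L * x * (y i - y j))))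
    = (\<Sum>i\<in>I. \<Sum>j\<in>I. c i j * exp (- (L * (y i - y j))\<^sup>2 / 2))"
proof -
  have int: "complex_integrable std_normal_distribution (\<lambda>x. cis (L * x * (y i - y j)))" for i j
    by (rule integrable_std_normal_bounded[where B = 1]) (auto intro!: continuous_intros)
  have "(CLINT x|std_normal_distribution. cis (L * x * (y i - y j))) = complex_of_real (exp (- (L * (y i - y j))\<^sup>2 / 2))" for i j
    using integral_cis_std_normal[of "L * (y i - y j)"] by (simp add: mult_ac)
  then show ?thesis
    using int by (simp add: Bochner_Integration.integral_sum exp_of_real)
qed

text \<open>After rescaling by \<open>L\<close>, the standard normal density is at least
  \<open>1 / 9\<close> on \<open>{-1..1}\<close>. Passing from a sharp cutoff to the Gaussian makes
  the means of exponential sums explicitly computable.\<close>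

lemma gaussian_dominates_interval:
  fixes f :: "real \<Rightarrow> real"
  assumes cont: "continuous_on UNIV f" and nn: "\<And>x. 0 \<le> f x" and bd: "\<And>x. f x \<le> B" and L: "0 < L"
  shows "integral {-L..L} f \<le> 9 * L * (LINT x|std_normal_distribution. f (L * x))"
proof -
  have c1: "continuous_on UNIV (\<lambda>x. f (L * x))"
    by (rule continuous_on_compose2[OF cont]) (auto intro!: continuous_intros)
  have meas: "(\<lambda>x. f (L * x)) \<in> borel_measurable borel"
    using borel_measurable_continuous_onI[OF c1] .
  have "integrable std_normal_distribution (\<lambda>x. f (L * x))"
    by (rule integrable_std_normal_bounded[where B = B, OF c1]) (use nn bd in auto)
  then have intN: "integrable lborel (\<lambda>x. std_normal_density x * f (L * x))"
    using meas by (simp add: integrable_density)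
  have intI: "set_integrable lborel {-L..L} f"
    by (intro borel_integrable_atLeastAtMost' continuous_on_subset[OF cont]) auto
  have int1: "set_integrable lborel {-1..1} (\<lambda>x. f (L * x))"
    by (intro borel_integrable_atLeastAtMost' continuous_on_subset[OF c1]) auto
  have "integral {-L..L} f = (LINT x:{-L..L}|lborel. f x)"
    using set_borel_integral_eq_integral[OF intI] by simp
  also have "\<dots> = L * (LINT x:{-1..1}|lborel. f (L * x))"
  proof -
    have "indicator {-L..L} (L * x) = (indicator {-1..1} x :: real)" for x
    proof -
      have "L * x \<in> {-L..L} \<longleftrightarrow> x \<in> {-1..1}"
        using mult_le_cancel_left_pos[OF L, of "-1" x] mult_le_cancel_left_pos[OF L, of x 1] by simp
      then show ?thesis by (simp only: indicator_def)
    qed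
    then show ?thesis
      unfolding set_lebesgue_integral_def
      using lborel_integral_real_affine[of L "\<lambda>x. indicator {-L..L} x *\<^sub>R f x" 0] L by simp
  qed
  also have "(LINT x:{-1..1}|lborel. f (L * x)) \<le> (LINT x|lborel. 9 * (std_normal_density x * f (L * x)))"
    unfolding set_lebesgue_integral_def
  proof (intro integral_mono)
    show "integrable lborel (\<lambda>x. indicat_real {- 1..1} x *\<^sub>R f (L * x))"
      using int1 by (simp add: set_integrable_def)
    show "integrable lborel (\<lambda>x. 9 * (std_normal_density x * f (L * x)))" using intN by simp
    show "indicat_real {- 1..1} x *\<^sub>R f (L * x) \<le> 9 * (std_normal_density x * f (L * x))" for x
    proof (cases "x \<in> {-1..1}")
      case True
      \<comment> \<open>Both the exponential factor and the normalising factor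
        \<open>1 / sqrt (2 * pi)\<close> are at least \<open>1 / 3\<close>.\<close>
      have "x\<^sup>2 \<le> 1" using True by (auto simp: abs_square_le_1)
      then have "exp (-1) \<le> exp (- x\<^sup>2 / 2)" by simp
      moreover have "1 / 3 \<le> exp (-1::real)" using exp_le by (simp add: exp_minus field_simps)
      moreover have "sqrt (2 * pi) \<le> sqrt (3\<^sup>2)" using pi_less_4 by (intro real_sqrt_le_mono) simp
      then have "1 / 3 \<le> 1 / sqrt (2 * pi)" by (intro divide_left_mono) auto
      ultimately have "(1 / 3) * (1 / 3) \<le> std_normal_density x"
        unfolding std_normal_density_def by (intro mult_mono order_trans[OF _ \<open>exp (-1) \<le> _\<close>]) auto
      then have "1 * f (L * x) \<le> (9 * std_normal_density x) * f (L * x)"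
        using nn by (intro mult_right_mono) auto
      then show ?thesis using True by simp
    next
      case False
      then show ?thesis using nn by simp
    qed
  qed
  also have "(LINT x|lborel. 9 * (std_normal_density x * f (L * x))) = 9 * (LINT x|std_normal_distribution. f (L * x))"
    using meas by (simp add: integral_density)
  finally show ?thesis using L by (simp add: mult_ac)
qed

text \<open>Cauchy-Schwarz against a constant, obtained from the nonnegativity of the variance of
  \<open>f\<close> about its mean \<open>m\<close>.\<close>

lemma integral_square_le:
  fixes f :: "real \<Rightarrow> real"
  assumes "continuous_on {a..b} f" "a < b"
  shows "(integral {a..b} f)\<^sup>2 \<le> (b - a) * integral {a..b} (\<lambda>x. (f x)\<^sup>2)"
proof -
  define m where "m = integral {a..b} f / (b - a)"
  have i: "f integrable_on {a..b}" "(\<lambda>x. (f x)\<^sup>2) integrable_on {a..b}"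
    using assms by (auto intro!: integrable_continuous_interval continuous_intros)
  have "0 \<le> integral {a..b} (\<lambda>x. (f x - m)\<^sup>2)"
    using assms by (intro integral_nonneg integrable_continuous_interval continuous_intros) auto
  also have "\<dots> = integral {a..b} (\<lambda>x. (f x)\<^sup>2 - (2 * m) * f x + m\<^sup>2)"
    by (simp add: power2_diff algebra_simps)
  also have "\<dots> = integral {a..b} (\<lambda>x. (f x)\<^sup>2) - 2 * m * integral {a..b} f + (b - a) * m\<^sup>2"
    using assms(2) has_integral_const_real[of "m\<^sup>2" a b]
    by (intro integral_unique has_integral_add has_integral_diff has_integral_mult_right integrable_integral i) simp
  also have "\<dots> = integral {a..b} (\<lambda>x. (f x)\<^sup>2) - (integral {a..b} f)\<^sup>2 / (b - a)"
  proof -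
    have "integral {a..b} f = (b - a) * m" using assms(2) by (simp add: m_def)
    then show ?thesis using assms(2) by (simp add: power2_eq_square)
  qed
  finally show ?thesis using assms(2) by (simp add: field_simps)
qed

text \<open>
  Averaging over an interval of radius \<open>h\<close> multiplies the coefficients by \<open>g\<close>.  Frequencies of size
  at most \<open>1 / h\<close> keep \<open>g\<close> away from zero, so the averaging can be undone on the coefficients.
\<close>
lemma exponential_sum_le_local_mean:
  fixes u :: "'i \<Rightarrow> real" and h :: real
  assumes h: "0 < h" and I: "finite I" and u: "\<And>i. i \<in> I \<Longrightarrow> h * \<bar>u i\<bar> \<le> 1"
  obtains g where "\<And>i. i \<in> I \<Longrightarrow> h \<le> cmod (g i)"
    "\<And>d c. (cmod (\<Sum>i\<in>I. d i * cis (c * u i)))\<^sup>2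
       \<le> 2 * h * integral {c - h..c + h} (\<lambda>\<xi>. (cmod (\<Sum>i\<in>I. d i / g i * cis (\<xi> * u i)))\<^sup>2)"
proof
  define g where "g = (\<lambda>i. integral {-h..h} (\<lambda>\<eta>. cis (\<eta> * u i)))"
  have int: "(\<lambda>\<xi>. cis (\<xi> * u i)) integrable_on {p..q}" for i p q
    by (auto intro!: integrable_continuous_interval continuous_intros)
  show lower: "h \<le> cmod (g i)" if "i \<in> I" for i
  proof -
    \<comment> \<open>The real part suffices: on the window the phase is at most \<open>1\<close>,
      which is below \<open>pi / 3\<close>, so its cosine is at least \<open>1/2\<close>.\<close>
    have "h = integral {-h..h} (\<lambda>_. 1/2 :: real)" using h by simp
    also have "\<dots> \<le> integral {-h..h} (\<lambda>\<eta>. cos (\<eta> * u i))"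
    proof (intro integral_le)
      show "(\<lambda>\<eta>. cos (\<eta> * u i)) integrable_on {-h..h}"
        by (auto intro!: integrable_continuous_interval continuous_intros)
      fix \<eta> assume "\<eta> \<in> {-h..h}"
      then have "\<bar>\<eta> * u i\<bar> \<le> h * \<bar>u i\<bar>" by (auto simp: abs_mult intro!: mult_right_mono)
      then have "\<bar>\<eta> * u i\<bar> \<le> 1" using u[OF that] by simp
      then have "cos (pi / 3) \<le> cos \<bar>\<eta> * u i\<bar>"
        using pi_gt3 by (intro cos_monotone_0_pi_le) auto
      then show "1/2 \<le> cos (\<eta> * u i)" by (simp add: cos_60)
    qed auto
    also have "\<dots> = Re (g i)"
      using integral_linear[OF int[of i "-h" h] bounded_linear_Re] by (simp add: g_def o_def)
    also have "\<dots> \<le> cmod (g i)" by (rule complex_Re_le_cmod)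
    finally show ?thesis .
  qed
  have shift: "integral {c - h..c + h} (\<lambda>\<xi>. cis (\<xi> * u i)) = cis (c * u i) * g i" for c i
  proof -
    have "integral {c - h..c + h} (\<lambda>\<xi>. cis (\<xi> * u i)) = integral {-h..h} (\<lambda>\<eta>. cis ((\<eta> + c) * u i))"
      using integral_shift_Icc_real[of "-h" h "\<lambda>\<xi>. cis (\<xi> * u i)" c]
      by (simp add: o_def add.commute)
    also have "\<dots> = integral {-h..h} (\<lambda>\<eta>. cis (c * u i) * cis (\<eta> * u i))"
      by (simp add: cis_mult algebra_simps)
    also have "\<dots> = cis (c * u i) * g i" by (simp add: g_def)
    finally show ?thesis .
  qed
  show "(cmod (\<Sum>i\<in>I. d i * cis (c * u i)))\<^sup>2
       \<le> 2 * h * integral {c - h..c + h} (\<lambda>\<xi>. (cmod (\<Sum>i\<in>I. d i / g i * cis (\<xi> * u i)))\<^sup>2)" for d c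
  proof -
    let ?G = "\<lambda>\<xi>. \<Sum>i\<in>I. d i / g i * cis (\<xi> * u i)"
    have cont: "continuous_on S ?G" for S by (intro continuous_intros)
    \<comment> \<open>The division by \<open>g i\<close> cancels the factor produced by integrating
      over the window, so the integral is exactly the original sum at \<open>c\<close>.\<close>
    have "integral {c - h..c + h} ?G = (\<Sum>i\<in>I. d i / g i * (cis (c * u i) * g i))"
      using integrable_integral[OF int] shift
      by (intro integral_unique has_integral_sum I has_integral_mult_right) metis
    also have "\<dots> = (\<Sum>i\<in>I. d i * cis (c * u i))"
    proof (intro sum.cong refl)
      fix i assume "i \<in> I"
      then have "g i \<noteq> 0" using lower[of i] h by auto
      then show "d i / g i * (cis (c * u i) * g i) = d i * cis (c * u i)" by simp
    qed
    finally have "cmod (\<Sum>i\<in>I. d i * cis (c * u i)) = cmod (integral {c - h..c + h} ?G)" by simp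
    also have "\<dots> \<le> integral {c - h..c + h} (\<lambda>\<xi>. cmod (?G \<xi>))"
      by (intro integral_norm_bound_integral integrable_continuous_interval continuous_intros cont) auto
    finally have "(cmod (\<Sum>i\<in>I. d i * cis (c * u i)))\<^sup>2 \<le> (integral {c - h..c + h} (\<lambda>\<xi>. cmod (?G \<xi>)))\<^sup>2"
      by (intro power_mono) auto
    also have "\<dots> \<le> (c + h - (c - h)) * integral {c - h..c + h} (\<lambda>\<xi>. (cmod (?G \<xi>))\<^sup>2)"
      using h by (intro integral_square_le continuous_intros) auto
    finally show ?thesis by simp
  qed
qed

section \<open>The mean square over a dyadic block of frequencies\<close>

text \<open>Sum and integral are interchanged: a given \<open>\<xi>\<close> lies only in the windows
  of those \<open>t\<close> within \<open>1 / (2 * R)\<close> of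
  \<open>\<xi> / (\<kappa> * \<rho>)\<close>, and the Frostman condition bounds their mass. This is
  where averaging over directions gains \<open>R powr - a\<close>.\<close>

lemma frostman_weights_interval_integrals:
  fixes f :: "real \<Rightarrow> real"
  assumes F: "frostman_weights K a n P p"
    and cont: "continuous_on UNIV f" and nn: "\<And>x. 0 \<le> f x"
    and h: "0 < h" "2 * h \<le> 1" and \<kappa>: "1 \<le> \<bar>\<kappa>\<bar>" and R: "1 \<le> R" "R \<le> \<rho>" "R \<le> 2 ^ n"
    and L: "\<And>t. t \<in> P \<Longrightarrow> \<bar>\<kappa> * \<rho> * t\<bar> + h \<le> L"
  shows "(\<Sum>t\<in>P. p t * integral {\<kappa> * \<rho> * t - h..\<kappa> * \<rho> * t + h} f) \<le> K * R powr - a * integral {-L..L} f"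
proof (rule has_integral_le)
  note D = frostman_weightsD[OF F]
  let ?J = "\<lambda>t. {\<kappa> * \<rho> * t - h..\<kappa> * \<rho> * t + h}"
  have int: "f integrable_on {u..v}" for u v
    by (intro integrable_continuous_interval continuous_on_subset[OF cont]) auto
  have "((\<lambda>\<xi>. if \<xi> \<in> ?J t then f \<xi> else 0) has_integral integral (?J t) f) {-L..L}" if "t \<in> P" for t
    using L[OF that] int by (subst has_integral_restrict) (auto simp: integrable_integral)
  then show "((\<lambda>\<xi>. \<Sum>t\<in>P. p t * (if \<xi> \<in> ?J t then f \<xi> else 0)) has_integral (\<Sum>t\<in>P. p t * integral (?J t) f)) {-L..L}"
    using D(1) by (intro has_integral_sum has_integral_mult_right) auto
  show "((\<lambda>\<xi>. K * R powr - a * f \<xi>) has_integral K * R powr - a * integral {-L..L} f) {-L..L}"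
    using int by (intro has_integral_mult_right integrable_integral)
  fix \<xi>
  have \<kappa>\<rho>: "R \<le> \<bar>\<kappa> * \<rho>\<bar>"
    using mult_mono[of 1 "\<bar>\<kappa>\<bar>" R "\<bar>\<rho>\<bar>"] \<kappa> R by (simp add: abs_mult)
  \<comment> \<open>Left end of the interval of length \<open>1 / R\<close> centred at
    \<open>\<xi> / (\<kappa> * \<rho>)\<close>.\<close>
  define x where "x = \<xi> / (\<kappa> * \<rho>) - 1 / (2 * R)"
  have sub: "{t \<in> P. \<xi> \<in> ?J t} \<subseteq> P \<inter> {x..x + 1 / R}"
  proof
    fix t assume t: "t \<in> {t \<in> P. \<xi> \<in> ?J t}"
    have "\<bar>\<kappa> * \<rho>\<bar> * \<bar>\<xi> / (\<kappa> * \<rho>) - t\<bar> = \<bar>\<xi> - \<kappa> * \<rho> * t\<bar>"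
      using \<kappa>\<rho> R by (auto simp: abs_mult[symmetric] right_diff_distrib)
    then have "\<bar>\<kappa> * \<rho>\<bar> * \<bar>\<xi> / (\<kappa> * \<rho>) - t\<bar> \<le> 1/2"
    proof -
      have "\<bar>\<xi> - \<kappa> * \<rho> * t\<bar> \<le> h" using t by (simp add: abs_le_iff)
      then show ?thesis using h(2) \<open>_ = \<bar>\<xi> - \<kappa> * \<rho> * t\<bar>\<close> by linarith
    qed
    moreover have "R * \<bar>\<xi> / (\<kappa> * \<rho>) - t\<bar> \<le> \<bar>\<kappa> * \<rho>\<bar> * \<bar>\<xi> / (\<kappa> * \<rho>) - t\<bar>"
      using \<kappa>\<rho> by (intro mult_right_mono) auto
    ultimately have "\<bar>\<xi> / (\<kappa> * \<rho>) - t\<bar> \<le> 1 / (2 * R)" using R by (simp add: field_simps)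
    then have "t \<in> {x..x + 1 / R}" using R by (auto simp: x_def abs_le_iff)
    then show "t \<in> P \<inter> {x..x + 1 / R}" using t by auto
  qed
  have "(1 / 2) ^ n \<le> 1 / R" using R by (simp add: power_divide field_simps)
  then have "sum p (P \<inter> {x..x + 1 / R}) \<le> K * (1 / R) powr a"
    using R by (intro D(4)) auto
  moreover have "(1 / R) powr a = R powr - a"
    using R by (subst powr_divide) (auto simp: powr_minus divide_inverse)
  moreover have "sum p {t \<in> P. \<xi> \<in> ?J t} \<le> sum p (P \<inter> {x..x + 1 / R})"
    using sub D(1,2) by (intro sum_mono2) auto
  ultimately have mass: "sum p {t \<in> P. \<xi> \<in> ?J t} \<le> K * R powr - a" by simp
  have "(\<Sum>t\<in>P. p t * (if \<xi> \<in> ?J t then f \<xi> else 0)) = (\<Sum>t\<in>P. if \<xi> \<in> ?J t then p t * f \<xi> else 0)"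
    by (intro sum.cong) auto
  also have "\<dots> = (\<Sum>t\<in>{t \<in> P. \<xi> \<in> ?J t}. p t * f \<xi>)"
    using D(1) by (simp add: sum.inter_filter)
  also have "\<dots> = sum p {t \<in> P. \<xi> \<in> ?J t} * f \<xi>" by (simp add: sum_distrib_right)
  also have "\<dots> \<le> K * R powr - a * f \<xi>" using mass nn by (intro mult_right_mono)
  finally show "(\<Sum>t\<in>P. p t * (if \<xi> \<in> ?J t then f \<xi> else 0)) \<le> K * R powr - a * f \<xi>" .
qed

text \<open>The sum at direction \<open>t\<close> is replaced by a window around
  \<open>\<kappa> * \<rho> * t\<close> in a second frequency variable \<open>\<xi>\<close>, and
  averaging over \<open>t\<close> spreads the windows over \<open>{-L..L}\<close>. The integrals
  over \<open>\<xi>\<close> and over \<open>\<rho>\<close> are then both dominated by Gaussian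
  means; each gives a factor \<open>9 * L\<close> and one Gaussian kernel.\<close>

lemma dyadic_block_bound:
  fixes \<mu> x w :: "'i \<Rightarrow> real"
  assumes F: "frostman_weights K a n P p"
    and I: "finite I" and \<mu>: "\<And>i. i \<in> I \<Longrightarrow> 0 \<le> \<mu> i"
    and h: "0 < h" "2 * h \<le> 1" "\<And>i. i \<in> I \<Longrightarrow> h * \<bar>x i\<bar> \<le> 1"
    and \<kappa>: "1 \<le> \<bar>\<kappa>\<bar>" and R: "1 \<le> R" "R \<le> 2 ^ n"
    and L: "2 * R \<le> L" "\<And>t. t \<in> P \<Longrightarrow> 2 * R * \<bar>\<kappa> * t\<bar> + h \<le> L"
  shows "integral {R..2 * R} (\<lambda>\<rho>. \<Sum>t\<in>P. p t * (cmod (\<Sum>i\<in>I. \<mu> i * cis (\<rho> * (\<kappa> * t * x i + w i))))\<^sup>2)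
    \<le> 2 * h * (K * R powr - a) * (9 * L) * (9 * L) / h\<^sup>2 *
      (\<Sum>i\<in>I. \<Sum>j\<in>I. \<mu> i * \<mu> j * exp (- (L * (x i - x j))\<^sup>2 / 2) * exp (- (L * (w i - w j))\<^sup>2 / 2))"
proof -
  note D = frostman_weightsD[OF F]
  interpret N: real_distribution std_normal_distribution by (rule real_dist_normal_dist)
  obtain g where g: "\<And>i. i \<in> I \<Longrightarrow> h \<le> cmod (g i)"
    "\<And>d c. (cmod (\<Sum>i\<in>I. d i * cis (c * x i)))\<^sup>2
       \<le> 2 * h * integral {c - h..c + h} (\<lambda>\<xi>. (cmod (\<Sum>i\<in>I. d i / g i * cis (\<xi> * x i)))\<^sup>2)"
    using exponential_sum_le_local_mean[of h I x, OF h(1) I h(3)] by blast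
  define e where "e = (\<lambda>i. \<mu> i / g i)"
  define f where "f = (\<lambda>\<rho> \<xi>. (cmod (\<Sum>i\<in>I. e i * cis (\<rho> * w i) * cis (\<xi> * x i)))\<^sup>2)"
  \<comment> \<open>Only \<open>\<xi>\<close> is averaged so far; \<open>H\<close> is still a
    trigonometric sum in \<open>\<rho>\<close>, which makes a second average possible.\<close>
  define H where "H = (\<lambda>\<rho>. LINT y|std_normal_distribution. f \<rho> (L * y))"
  define C where "C = 2 * h * (K * R powr - a) * (9 * L)"
  define T where "T = (\<Sum>i\<in>I. cmod (e i))"
  have L0: "0 < L" using R L by linarith
  have K0: "0 \<le> K" by (rule frostman_weights_const_nonneg[OF F])
  have C0: "0 \<le> C" using K0 h L0 by (simp add: C_def)
  have fcont: "continuous_on S (f \<rho>)" for \<rho> S unfolding f_def by (intro continuous_intros)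
  have f0: "0 \<le> f \<rho> \<xi>" for \<rho> \<xi> by (simp add: f_def)
  have fT: "f \<rho> \<xi> \<le> T\<^sup>2" for \<rho> \<xi>
    unfolding f_def T_def
    by (intro power_mono order_trans[OF norm_sum] sum_mono) (auto simp: norm_mult)
  have fint: "integrable std_normal_distribution (\<lambda>y. f \<rho> (L * y))" for \<rho>
    by (rule integrable_std_normal_bounded[where B = "T\<^sup>2"])
       (use f0 fT in \<open>auto intro!: continuous_on_compose2[OF fcont[of UNIV]] continuous_intros\<close>)
  have fsum: "complex_of_real (f \<rho> \<xi>) =
     (\<Sum>i\<in>I. \<Sum>j\<in>I. (e i * cnj (e j) * cis (\<rho> * (w i - w j))) * cis (\<xi> * (x i - x j)))" for \<rho> \<xi>
  proof -
    have "cis (r * (s - t)) = cis (r * s) * cis (- (r * t))" for r s t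
      by (simp add: cis_mult right_diff_distrib)
    then show ?thesis
      unfolding f_def cmod_sum_square by (intro sum.cong refl) (simp add: cis_cnj mult_ac)
  qed
  define E where "E = (\<lambda>i j. exp (- (L * (x i - x j))\<^sup>2 / 2))"
  have Hsum: "complex_of_real (H \<rho>) =
     (\<Sum>i\<in>I. \<Sum>j\<in>I. (e i * cnj (e j) * E i j) * cis (\<rho> * (w i - w j)))" for \<rho>
  proof -
    have "complex_of_real (H \<rho>) = (CLINT y|std_normal_distribution. complex_of_real (f \<rho> (L * y)))"
      unfolding H_def by simp
    also have "\<dots> = (\<Sum>i\<in>I. \<Sum>j\<in>I. (e i * cnj (e j) * cis (\<rho> * (w i - w j))) * E i j)"
      unfolding fsum gaussian_mean_double_sum[OF I] E_def ..
    finally show ?thesis by (simp add: mult_ac)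
  qed
  have H0: "0 \<le> H \<rho>" for \<rho> unfolding H_def by (intro Bochner_Integration.integral_nonneg f0)
  have HT: "H \<rho> \<le> T\<^sup>2" for \<rho>
    unfolding H_def using fint fT by (intro N.integral_le_const) auto
  have HRe: "H = (\<lambda>\<rho>. Re (\<Sum>i\<in>I. \<Sum>j\<in>I. (e i * cnj (e j) * E i j) * cis (\<rho> * (w i - w j))))"
    unfolding Hsum[symmetric] by simp
  have Hcont: "continuous_on S H" for S unfolding HRe by (intro continuous_intros)
  have pointwise: "(\<Sum>t\<in>P. p t * (cmod (\<Sum>i\<in>I. \<mu> i * cis (\<rho> * (\<kappa> * t * x i + w i))))\<^sup>2) \<le> C * H \<rho>"
    if \<rho>: "\<rho> \<in> {R..2 * R}" for \<rho>
  proof -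
    have "(cmod (\<Sum>i\<in>I. \<mu> i * cis (\<rho> * (\<kappa> * t * x i + w i))))\<^sup>2
        \<le> 2 * h * integral {\<kappa> * \<rho> * t - h..\<kappa> * \<rho> * t + h} (f \<rho>)" for t
    proof -
      have "(\<Sum>i\<in>I. \<mu> i * cis (\<rho> * (\<kappa> * t * x i + w i))) = (\<Sum>i\<in>I. (\<mu> i * cis (\<rho> * w i)) * cis (\<kappa> * \<rho> * t * x i))"
        by (intro sum.cong refl) (simp add: cis_mult algebra_simps)
      then show ?thesis
        using g(2)[of "\<lambda>i. \<mu> i * cis (\<rho> * w i)" "\<kappa> * \<rho> * t"] by (simp add: f_def e_def mult_ac)
    qed
    then have "(\<Sum>t\<in>P. p t * (cmod (\<Sum>i\<in>I. \<mu> i * cis (\<rho> * (\<kappa> * t * x i + w i))))\<^sup>2)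
        \<le> (\<Sum>t\<in>P. p t * (2 * h * integral {\<kappa> * \<rho> * t - h..\<kappa> * \<rho> * t + h} (f \<rho>)))"
      using D(2) by (intro sum_mono mult_left_mono) auto
    also have "\<dots> = 2 * h * (\<Sum>t\<in>P. p t * integral {\<kappa> * \<rho> * t - h..\<kappa> * \<rho> * t + h} (f \<rho>))"
      by (simp add: sum_distrib_left mult_ac)
    also have "\<dots> \<le> 2 * h * (K * R powr - a * integral {-L..L} (f \<rho>))"
    proof (intro mult_left_mono frostman_weights_interval_integrals[OF F] fcont f0)
      fix t assume "t \<in> P"
      have "\<bar>\<kappa> * \<rho> * t\<bar> = \<rho> * \<bar>\<kappa> * t\<bar>" using \<rho> R by (simp add: abs_mult)
      also have "\<dots> \<le> 2 * R * \<bar>\<kappa> * t\<bar>" using \<rho> by (intro mult_right_mono) auto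
      finally show "\<bar>\<kappa> * \<rho> * t\<bar> + h \<le> L" using L(2)[OF \<open>t \<in> P\<close>] by linarith
    qed (use h \<kappa> R \<rho> in auto)
    also have "\<dots> \<le> 2 * h * (K * R powr - a * (9 * L * H \<rho>))"
      unfolding H_def using K0 h
      by (intro mult_left_mono gaussian_dominates_interval[OF fcont f0 fT L0]) auto
    finally show ?thesis by (simp add: C_def mult_ac)
  qed
  have "integral {R..2 * R} (\<lambda>\<rho>. \<Sum>t\<in>P. p t * (cmod (\<Sum>i\<in>I. \<mu> i * cis (\<rho> * (\<kappa> * t * x i + w i))))\<^sup>2)
      \<le> integral {R..2 * R} (\<lambda>\<rho>. C * H \<rho>)"
    by (intro integral_le pointwise integrable_continuous_interval continuous_intros Hcont)
  \<comment> \<open>Since \<open>H\<close> is nonnegative, the block may be enlarged to a symmetric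
    interval, to which the Gaussian majorant applies again.\<close>
  also have "\<dots> \<le> integral {-L..L} (\<lambda>\<rho>. C * H \<rho>)"
    using R L C0 H0 by (intro integral_subset_le integrable_continuous_interval continuous_intros Hcont) auto
  also have "\<dots> = C * integral {-L..L} H" by simp
  also have "\<dots> \<le> C * (9 * L * (LINT y|std_normal_distribution. H (L * y)))"
    by (intro mult_left_mono gaussian_dominates_interval[OF Hcont H0 HT L0] C0)
  also have "\<dots> \<le> C * (9 * L * ((\<Sum>i\<in>I. \<Sum>j\<in>I. \<mu> i * \<mu> j * E i j * exp (- (L * (w i - w j))\<^sup>2 / 2)) / h\<^sup>2))"
  proof (intro mult_left_mono)
    have "complex_of_real (LINT y|std_normal_distribution. H (L * y)) =
        (CLINT y|std_normal_distribution. complex_of_real (H (L * y)))" by simp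
    also have "\<dots> = (\<Sum>i\<in>I. \<Sum>j\<in>I. (e i * cnj (e j) * E i j) * exp (- (L * (w i - w j))\<^sup>2 / 2))"
      unfolding Hsum gaussian_mean_double_sum[OF I] ..
    finally have "\<bar>LINT y|std_normal_distribution. H (L * y)\<bar>
        = cmod (\<Sum>i\<in>I. \<Sum>j\<in>I. (e i * cnj (e j) * E i j) * exp (- (L * (w i - w j))\<^sup>2 / 2))"
      by (metis norm_of_real real_norm_def)
    \<comment> \<open>The phases are given up here: the kernels are positive, and each corrected
      coefficient has modulus at most \<open>\<mu> k / h\<close>, whence the factor
      \<open>1 / h\<^sup>2\<close>.\<close>
    also have "\<dots> \<le> (\<Sum>i\<in>I. \<Sum>j\<in>I. \<mu> i * \<mu> j * E i j * exp (- (L * (w i - w j))\<^sup>2 / 2) / h\<^sup>2)"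
    proof (intro order_trans[OF norm_sum] sum_mono)
      fix i j assume ij: "i \<in> I" "j \<in> I"
      have ei: "cmod (e k) \<le> \<mu> k / h" if "k \<in> I" for k
        using g(1)[OF that] h \<mu>[OF that] by (auto simp: e_def norm_divide intro!: frac_le)
      have "cmod (e i) * cmod (e j) \<le> (\<mu> i / h) * (\<mu> j / h)"
        using ei[OF ij(1)] ei[OF ij(2)] \<mu>[OF ij(1)] h by (intro mult_mono) auto
      then have "cmod (e i) * cmod (e j) * (E i j * exp (- (L * (w i - w j))\<^sup>2 / 2))
         \<le> (\<mu> i / h) * (\<mu> j / h) * (E i j * exp (- (L * (w i - w j))\<^sup>2 / 2))"
        by (intro mult_right_mono) (auto simp: E_def)
      then show "cmod (e i * cnj (e j) * E i j * exp (- (L * (w i - w j))\<^sup>2 / 2))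
        \<le> \<mu> i * \<mu> j * E i j * exp (- (L * (w i - w j))\<^sup>2 / 2) / h\<^sup>2"
        by (simp add: norm_mult E_def power2_eq_square mult_ac)
    qed
    also have "\<dots> = (\<Sum>i\<in>I. \<Sum>j\<in>I. \<mu> i * \<mu> j * E i j * exp (- (L * (w i - w j))\<^sup>2 / 2)) / h\<^sup>2"
      by (simp add: sum_divide_distrib)
    finally show "(LINT y|std_normal_distribution. H (L * y)) \<le>
      (\<Sum>i\<in>I. \<Sum>j\<in>I. \<mu> i * \<mu> j * E i j * exp (- (L * (w i - w j))\<^sup>2 / 2)) / h\<^sup>2" by linarith
  qed (use C0 L0 in auto)
  finally show ?thesis by (simp add: C_def E_def)
qed

section \<open>Near pairs, Gaussian energy and counting of cells\<close>

text \<open>The triangular weight \<open>1 - \<rho> / N\<close> has a nonnegative cosine transform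
  \<open>D\<close> that is at least \<open>N / 4\<close> on
  \<open>\<bar>y\<bar> \<le> 1 / N\<close>, so \<open>4 / N * D\<close> dominates the indicator of
  near pairs. Expanding the squared modulus then turns the pair sum into a weighted
  integral.\<close>

lemma near_pairs_le_integral:
  fixes \<mu> \<phi> :: "'i \<Rightarrow> real"
  assumes I: "finite I" and \<mu>: "\<And>i. i \<in> I \<Longrightarrow> 0 \<le> \<mu> i" and N: "0 < N"
  shows "(\<Sum>i\<in>I. \<Sum>j\<in>I. \<mu> i * \<mu> j * of_bool (\<bar>\<phi> i - \<phi> j\<bar> \<le> 1 / N))
    \<le> 4 / N * integral {0..N} (\<lambda>\<rho>. (cmod (\<Sum>i\<in>I. \<mu> i * cis (\<rho> * \<phi> i)))\<^sup>2)"
proof -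
  define D where "D = (\<lambda>y. integral {0..N} (\<lambda>\<rho>. (1 - \<rho> / N) * cos (\<rho> * y)))"
  have Dint: "(\<lambda>\<rho>. (1 - \<rho> / N) * cos (\<rho> * y)) integrable_on {0..N}" for y
    using N by (auto intro!: integrable_continuous_interval continuous_intros)
  text \<open>The Fejer kernel: nonnegative, and comparable to \<open>N\<close> near the origin.\<close>
  have D0: "0 \<le> D y" for y
  proof (cases "y = 0")
    case True
    then show ?thesis
      unfolding D_def using N Dint[of 0] by (intro integral_nonneg) auto
  next
    case False
    \<comment> \<open>An antiderivative found by integrating by parts.\<close>
    define G where "G = (\<lambda>\<rho>. (1 - \<rho> / N) * sin (\<rho> * y) / y - cos (\<rho> * y) / (N * y\<^sup>2))"
    have "((\<lambda>\<rho>. (1 - \<rho> / N) * cos (\<rho> * y)) has_integral G N - G 0) {0..N}"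
    proof (rule fundamental_theorem_of_calculus)
      fix \<rho>
      have "(G has_real_derivative (1 - \<rho> / N) * cos (\<rho> * y)) (at \<rho> within {0..N})"
        unfolding G_def using N False
        by (auto intro!: derivative_eq_intros simp: field_simps power2_eq_square)
      then show "(G has_vector_derivative (1 - \<rho> / N) * cos (\<rho> * y)) (at \<rho> within {0..N})"
        by (simp add: has_real_derivative_iff_has_vector_derivative)
    qed (use N in simp)
    then have "D y = G N - G 0" by (simp add: D_def integral_unique)
    also have "\<dots> = (1 - cos (N * y)) / (N * y\<^sup>2)"
      using N by (simp add: G_def diff_divide_distrib)
    also have "\<dots> \<ge> 0" using N by simp
    finally show ?thesis .
  qed
  have D1: "N / 4 \<le> D y" if "\<bar>y\<bar> \<le> 1 / N" for y
  proof -
    \<comment> \<open>For phases of size at most \<open>1\<close> the cosine is at least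
      \<open>1/2\<close>, and the resulting minorant integrates to \<open>N / 4\<close>.\<close>
    have "((\<lambda>\<rho>. (1 - \<rho> / N) * (1/2)) has_integral (N - N\<^sup>2 / (2 * N)) * (1/2) - (0 - 0\<^sup>2 / (2 * N)) * (1/2)) {0..N}"
    proof (rule fundamental_theorem_of_calculus)
      fix \<rho>
      have "((\<lambda>\<rho>. (\<rho> - \<rho>\<^sup>2 / (2 * N)) * (1/2)) has_real_derivative (1 - \<rho> / N) * (1/2)) (at \<rho> within {0..N})"
        using N by (auto intro!: derivative_eq_intros simp: field_simps)
      then show "((\<lambda>\<rho>. (\<rho> - \<rho>\<^sup>2 / (2 * N)) * (1/2)) has_vector_derivative (1 - \<rho> / N) * (1/2)) (at \<rho> within {0..N})"
        by (simp add: has_real_derivative_iff_has_vector_derivative)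
    qed (use N in simp)
    then have "((\<lambda>\<rho>. (1 - \<rho> / N) * (1/2)) has_integral N / 4) {0..N}"
      using N by (simp add: power2_eq_square)
    then show ?thesis
    proof (rule has_integral_le)
      show "((\<lambda>\<rho>. (1 - \<rho> / N) * cos (\<rho> * y)) has_integral D y) {0..N}"
        unfolding D_def by (rule integrable_integral[OF Dint])
      fix \<rho> assume \<rho>: "\<rho> \<in> {0..N}"
      have "\<bar>\<rho> * y\<bar> \<le> N * (1 / N)" using \<rho> that N unfolding abs_mult by (intro mult_mono) auto
      then have "\<bar>\<rho> * y\<bar> \<le> 1" using N by simp
      then have "cos (pi / 3) \<le> cos \<bar>\<rho> * y\<bar>" using pi_gt3 by (intro cos_monotone_0_pi_le) auto
      then have "1/2 \<le> cos (\<rho> * y)" by (simp add: cos_60)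
      then show "(1 - \<rho> / N) * (1/2) \<le> (1 - \<rho> / N) * cos (\<rho> * y)"
        using \<rho> N by (intro mult_left_mono) auto
    qed
  qed
  have sq: "(cmod (\<Sum>i\<in>I. \<mu> i * cis (\<rho> * \<phi> i)))\<^sup>2 = (\<Sum>i\<in>I. \<Sum>j\<in>I. \<mu> i * \<mu> j * cos (\<rho> * (\<phi> i - \<phi> j)))" for \<rho>
  proof -
    have "(cmod (\<Sum>i\<in>I. \<mu> i * cis (\<rho> * \<phi> i)))\<^sup>2 = Re (\<Sum>i\<in>I. \<Sum>j\<in>I. (\<mu> i * cis (\<rho> * \<phi> i)) * cnj (\<mu> j * cis (\<rho> * \<phi> j)))"
      unfolding cmod_sum_square[symmetric] by simp
    also have "\<dots> = (\<Sum>i\<in>I. \<Sum>j\<in>I. \<mu> i * \<mu> j * cos (\<rho> * (\<phi> i - \<phi> j)))"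
      unfolding Re_sum by (intro sum.cong refl) (simp add: cos_diff right_diff_distrib algebra_simps)
    finally show ?thesis .
  qed
  have "(\<Sum>i\<in>I. \<Sum>j\<in>I. \<mu> i * \<mu> j * of_bool (\<bar>\<phi> i - \<phi> j\<bar> \<le> 1 / N)) \<le> (\<Sum>i\<in>I. \<Sum>j\<in>I. \<mu> i * \<mu> j * (4 / N * D (\<phi> i - \<phi> j)))"
  proof (intro sum_mono mult_left_mono)
    fix i j
    show "of_bool (\<bar>\<phi> i - \<phi> j\<bar> \<le> 1 / N) \<le> 4 / N * D (\<phi> i - \<phi> j)"
      using D0[of "\<phi> i - \<phi> j"] D1[of "\<phi> i - \<phi> j"] N
      by (cases "\<bar>\<phi> i - \<phi> j\<bar> \<le> 1 / N") (auto simp: field_simps)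
  qed (use \<mu> in auto)
  also have "\<dots> = 4 / N * (\<Sum>i\<in>I. \<Sum>j\<in>I. \<mu> i * \<mu> j * D (\<phi> i - \<phi> j))"
    by (simp add: sum_distrib_left mult_ac)
  also have "\<dots> \<le> 4 / N * integral {0..N} (\<lambda>\<rho>. (cmod (\<Sum>i\<in>I. \<mu> i * cis (\<rho> * \<phi> i)))\<^sup>2)"
  proof (rule mult_left_mono, rule has_integral_le)
    show "((\<lambda>\<rho>. \<Sum>i\<in>I. \<Sum>j\<in>I. \<mu> i * \<mu> j * ((1 - \<rho> / N) * cos (\<rho> * (\<phi> i - \<phi> j)))) has_integral
       (\<Sum>i\<in>I. \<Sum>j\<in>I. \<mu> i * \<mu> j * D (\<phi> i - \<phi> j))) {0..N}"
      unfolding D_def by (intro has_integral_sum I has_integral_mult_right integrable_integral Dint)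
    show "((\<lambda>\<rho>. (cmod (\<Sum>i\<in>I. \<mu> i * cis (\<rho> * \<phi> i)))\<^sup>2) has_integral integral {0..N} (\<lambda>\<rho>. (cmod (\<Sum>i\<in>I. \<mu> i * cis (\<rho> * \<phi> i)))\<^sup>2)) {0..N}"
      by (intro integrable_integral integrable_continuous_interval continuous_intros)
    fix \<rho> assume \<rho>: "\<rho> \<in> {0..N}"
    \<comment> \<open>The weight lies between \<open>0\<close> and \<open>1\<close>, so dropping it
      only enlarges the integrand.\<close>
    have "(\<Sum>i\<in>I. \<Sum>j\<in>I. \<mu> i * \<mu> j * ((1 - \<rho> / N) * cos (\<rho> * (\<phi> i - \<phi> j)))) = (1 - \<rho> / N) * (cmod (\<Sum>i\<in>I. \<mu> i * cis (\<rho> * \<phi> i)))\<^sup>2"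
      unfolding sq by (simp add: sum_distrib_left mult_ac)
    also have "\<dots> \<le> (cmod (\<Sum>i\<in>I. \<mu> i * cis (\<rho> * \<phi> i)))\<^sup>2"
      using \<rho> N by (intro mult_left_le_one_le) auto
    finally show "(\<Sum>i\<in>I. \<Sum>j\<in>I. \<mu> i * \<mu> j * ((1 - \<rho> / N) * cos (\<rho> * (\<phi> i - \<phi> j)))) \<le> (cmod (\<Sum>i\<in>I. \<mu> i * cis (\<rho> * \<phi> i)))\<^sup>2" .
  qed (use N in simp)
  finally show ?thesis .
qed

text \<open>With \<open>i\<close> and \<open>u\<close> fixed, the second coordinate is affine in
  \<open>v\<close> with slope at least \<open>m\<close> in modulus, so its Gaussian is dominated by
  one in \<open>v\<close> at scale \<open>m * R\<close>. Summing over \<open>v\<close> and then over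
  \<open>u\<close> applies \<open>frostman_weights_gaussian_sum\<close> twice; the outer sum has
  total mass \<open>1\<close>.\<close>

lemma gaussian_energy_le:
  fixes \<alpha> \<beta> :: "real \<Rightarrow> real"
  assumes U: "frostman_weights Kb b n P q" "0 < b" and V: "frostman_weights Kc c n Q s" "0 < c"
    and m: "0 < m" "m \<le> 1" "\<And>u. u \<in> P \<Longrightarrow> m \<le> \<bar>\<beta> u\<bar>"
    and R: "0 < R" "R \<le> 2 ^ n" "2 * R \<le> L"
    and \<mu>_def: "\<mu> = (\<lambda>(u, v). q u * s v)" and w_def: "w = (\<lambda>(u, v). \<alpha> u + \<beta> u * v)"
  shows "(\<Sum>i\<in>P \<times> Q. \<Sum>j\<in>P \<times> Q. \<mu> i * \<mu> j * exp (- (L * (fst i - fst j))\<^sup>2 / 2) * exp (- (L * (w i - w j))\<^sup>2 / 2))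
    \<le> ((4 * Kb + 1) * R powr - b) * ((4 * Kc + 1) * (m * R) powr - c)"
proof -
  note DU = frostman_weightsD[OF U(1)] and DV = frostman_weightsD[OF V(1)]
  define B where "B = (4 * Kb + 1) * R powr - b"
  define C where "C = (4 * Kc + 1) * (m * R) powr - c"
  have C0: "0 \<le> C" using frostman_weights_const_nonneg[OF V(1)] by (simp add: C_def)
  \<comment> \<open>The factor \<open>2\<close> in \<open>2 * R \<le> L\<close> absorbs the division
    by \<open>2\<close> in the exponent.\<close>
  have gauss: "exp (- (L * z)\<^sup>2 / 2) \<le> exp (- (R * z)\<^sup>2)" for z
  proof -
    have "(2 * R)\<^sup>2 \<le> L\<^sup>2" using R by (intro power_mono) auto
    moreover have "2 * R\<^sup>2 \<le> (2 * R)\<^sup>2" by (simp add: power_mult_distrib)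
    ultimately have "2 * R\<^sup>2 \<le> L\<^sup>2" by linarith
    then have "2 * R\<^sup>2 * z\<^sup>2 \<le> L\<^sup>2 * z\<^sup>2" by (intro mult_right_mono) auto
    then show ?thesis by (simp add: power_mult_distrib)
  qed
  have V': "(\<Sum>v\<in>Q. s v * exp (- (L * (z - (\<alpha> u + \<beta> u * v)))\<^sup>2 / 2)) \<le> C" if u: "u \<in> P" for z u
  proof -
    \<comment> \<open>The value of \<open>v\<close> at which the affine map reaches
      \<open>z\<close>, hence the centre of the Gaussian in \<open>v\<close>.\<close>
    define y where "y = (z - \<alpha> u) / \<beta> u"
    have \<beta>: "\<beta> u * y = z - \<alpha> u" using m(1) m(3)[OF u] by (auto simp: y_def)
    have "(\<Sum>v\<in>Q. s v * exp (- (L * (z - (\<alpha> u + \<beta> u * v)))\<^sup>2 / 2)) \<le> (\<Sum>v\<in>Q. s v * exp (- (m * R * (v - y))\<^sup>2))"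
    proof (intro sum_mono mult_left_mono)
      fix v
      have "exp (- (L * (z - (\<alpha> u + \<beta> u * v)))\<^sup>2 / 2) \<le> exp (- (R * (z - (\<alpha> u + \<beta> u * v)))\<^sup>2)" by (rule gauss)
      also have "\<dots> \<le> exp (- (m * R * (v - y))\<^sup>2)"
      proof -
        have "m\<^sup>2 \<le> \<bar>\<beta> u\<bar>\<^sup>2" using m(1) m(3)[OF u] by (intro power_mono) auto
        then have "m\<^sup>2 * (R\<^sup>2 * (v - y)\<^sup>2) \<le> (\<beta> u)\<^sup>2 * (R\<^sup>2 * (v - y)\<^sup>2)" by (intro mult_right_mono) auto
        moreover have "z - (\<alpha> u + \<beta> u * v) = - (\<beta> u * (v - y))"
          using \<beta> by (simp add: right_diff_distrib)
        ultimately show ?thesis by (simp add: power_mult_distrib mult_ac)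
      qed
      finally show "exp (- (L * (z - (\<alpha> u + \<beta> u * v)))\<^sup>2 / 2) \<le> exp (- (m * R * (v - y))\<^sup>2)" .
    qed (use DV in auto)
    also have "\<dots> \<le> C" unfolding C_def
    proof (rule frostman_weights_gaussian_sum[OF V])
      have "m * R \<le> R" using m R by (intro mult_left_le_one_le) auto
      then show "m * R \<le> 2 ^ n" using R by linarith
    qed (use m R in simp)
    finally show ?thesis .
  qed
  have inner: "(\<Sum>j\<in>P \<times> Q. \<mu> j * exp (- (L * (fst i - fst j))\<^sup>2 / 2) * exp (- (L * (w i - w j))\<^sup>2 / 2)) \<le> B * C" for i
  proof -
    have "(\<Sum>j\<in>P \<times> Q. \<mu> j * exp (- (L * (fst i - fst j))\<^sup>2 / 2) * exp (- (L * (w i - w j))\<^sup>2 / 2)) =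
      (\<Sum>u\<in>P. q u * exp (- (L * (fst i - u))\<^sup>2 / 2) * (\<Sum>v\<in>Q. s v * exp (- (L * (w i - (\<alpha> u + \<beta> u * v)))\<^sup>2 / 2)))"
      unfolding sum_distrib_left sum.cartesian_product
      by (intro sum.cong refl) (auto simp: \<mu>_def w_def)
    also have "\<dots> \<le> (\<Sum>u\<in>P. q u * exp (- (R * (u - fst i))\<^sup>2) * C)"
    proof (intro sum_mono mult_mono V')
      fix u assume u: "u \<in> P"
      have "(R * (u - fst i))\<^sup>2 = (R * (fst i - u))\<^sup>2" 
        by (simp only: power_mult_distrib power2_commute[of u])
      then show "exp (- (L * (fst i - u))\<^sup>2 / 2) \<le> exp (- (R * (u - fst i))\<^sup>2)"
        using gauss[of "fst i - u"] by simp
      show "0 \<le> (\<Sum>v\<in>Q. s v * exp (- (L * (w i - (\<alpha> u + \<beta> u * v)))\<^sup>2 / 2))"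
        using DV(2) by (intro sum_nonneg) auto
    qed (use DU in auto)
    also have "\<dots> = (\<Sum>u\<in>P. q u * exp (- (R * (u - fst i))\<^sup>2)) * C" by (simp add: sum_distrib_right)
    also have "\<dots> \<le> B * C"
      unfolding B_def by (intro mult_right_mono frostman_weights_gaussian_sum[OF U] R C0)
    finally show ?thesis .
  qed
  have "(\<Sum>i\<in>P \<times> Q. \<Sum>j\<in>P \<times> Q. \<mu> i * \<mu> j * exp (- (L * (fst i - fst j))\<^sup>2 / 2) * exp (- (L * (w i - w j))\<^sup>2 / 2))
    = (\<Sum>i\<in>P \<times> Q. \<mu> i * (\<Sum>j\<in>P \<times> Q. \<mu> j * exp (- (L * (fst i - fst j))\<^sup>2 / 2) * exp (- (L * (w i - w j))\<^sup>2 / 2)))"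
    by (simp add: sum_distrib_left mult_ac)
  also have "\<dots> \<le> (\<Sum>i\<in>P \<times> Q. \<mu> i * (B * C))"
    using DU(2) DV(2) by (intro sum_mono mult_left_mono inner) (auto simp: \<mu>_def)
  also have "\<dots> = sum \<mu> (P \<times> Q) * (B * C)" by (simp add: sum_distrib_right)
  also have "sum \<mu> (P \<times> Q) = sum q P * sum s Q"
    unfolding \<mu>_def sum_product sum.cartesian_product ..
  finally show ?thesis using DU(3) DV(3) by (simp add: B_def C_def)
qed

text \<open>The interval \<open>{0..1}\<close> contributes at most \<open>1\<close>; the blocks
  above it are bounded by a geometric series, uniformly in \<open>n\<close>.\<close>

lemma integral_le_dyadic_blocks:
  fixes E :: "real \<Rightarrow> real"
  assumes cont: "continuous_on UNIV E" and E1: "\<And>\<rho>. E \<rho> \<le> 1"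
    and blk: "\<And>k. k < n \<Longrightarrow> integral {2 ^ k..2 * 2 ^ k} E \<le> C * \<theta> ^ k"
    and C: "0 \<le> C" and \<theta>: "0 < \<theta>" "\<theta> < 1"
  shows "integral {0..2 ^ n} E \<le> 1 + C / (1 - \<theta>)"
proof -
  have int: "E integrable_on {u..v}" for u v
    by (intro integrable_continuous_interval continuous_on_subset[OF cont]) auto
  have "integral {0..2 ^ n} E \<le> 1 + C * (\<Sum>k<n. \<theta> ^ k)" using blk
  proof (induction n)
    case 0
    have "integral {0..1} E \<le> 1"
      using integral_le[OF int[of 0 1] integrable_const_ivl[of 1]] E1 by simp
    then show ?case by simp
  next
    case (Suc n)
    have "integral {0..2 ^ Suc n} E = integral {0..2 ^ n} E + integral {2 ^ n..2 * 2 ^ n} E"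
      by (subst Henstock_Kurzweil_Integration.integral_combine) (auto intro: int)
    also have "\<dots> \<le> (1 + C * (\<Sum>k<n. \<theta> ^ k)) + C * \<theta> ^ n"
      using Suc.IH Suc.prems by (intro add_mono) auto
    finally show ?case by (simp add: algebra_simps)
  qed
  also have "(\<Sum>k<n. \<theta> ^ k) \<le> 1 / (1 - \<theta>)"
  proof -
    have "(\<Sum>k<n. \<theta> ^ k) \<le> (\<Sum>k. \<theta> ^ k)" using \<theta> by (intro sum_le_suminf summable_geometric) auto
    then show ?thesis using \<theta> by (simp add: suminf_geometric)
  qed
  finally show ?thesis using C by (simp add: mult_left_mono)
qed

text \<open>Points in a common cell are within \<open>1 / N\<close>, so the squares of the cell
  masses add up to at most \<open>C / N\<close>. By Cauchy-Schwarz, mass \<open>1\<close> with such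
  a small sum of squares must occupy many cells.\<close>

lemma card_cells_lower_bound:
  fixes \<mu> \<phi> :: "'i \<Rightarrow> real"
  assumes I: "finite I" and \<mu>: "\<And>i. i \<in> I \<Longrightarrow> 0 \<le> \<mu> i" and tot: "sum \<mu> I = 1" and N: "0 < N"
    and near: "(\<Sum>i\<in>I. \<Sum>j\<in>I. \<mu> i * \<mu> j * of_bool (\<bar>\<phi> i - \<phi> j\<bar> \<le> 1 / N)) \<le> C / N"
  shows "N \<le> C * card ((\<lambda>i. \<lfloor>\<phi> i * N\<rfloor>) ` I)"
proof -
  define z where "z = (\<lambda>i. \<lfloor>\<phi> i * N\<rfloor>)"
  define Z where "Z = z ` I"
  define M where "M = (\<lambda>k. sum \<mu> {i \<in> I. z i = k})"
  have "1 = (\<Sum>k\<in>Z. M k)" unfolding tot[symmetric] M_def Z_def by (rule sum.image_gen[OF I])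
  then have "1 = (\<Sum>k\<in>Z. 1 * M k)\<^sup>2" by simp
  also have "\<dots> \<le> (\<Sum>k\<in>Z. 1\<^sup>2) * (\<Sum>k\<in>Z. (M k)\<^sup>2)" by (rule Cauchy_Schwarz_ineq_sum)
  also have "(\<Sum>k\<in>Z. (M k)\<^sup>2) = (\<Sum>k\<in>Z. \<Sum>i | i \<in> I \<and> z i = k. \<Sum>j\<in>I. \<mu> i * \<mu> j * of_bool (z i = z j))"
  proof (intro sum.cong refl)
    fix k
    have "(M k)\<^sup>2 = (\<Sum>i | i \<in> I \<and> z i = k. \<Sum>j | j \<in> I \<and> z j = k. \<mu> i * \<mu> j)"
      unfolding M_def power2_eq_square by (rule sum_product)
    also have "\<dots> = (\<Sum>i | i \<in> I \<and> z i = k. \<Sum>j\<in>I. \<mu> i * \<mu> j * of_bool (z i = z j))"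
      using I by (intro sum.cong refl sum.mono_neutral_cong_left) auto
    finally show "(M k)\<^sup>2 = (\<Sum>i | i \<in> I \<and> z i = k. \<Sum>j\<in>I. \<mu> i * \<mu> j * of_bool (z i = z j))" .
  qed
  also have "\<dots> = (\<Sum>i\<in>I. \<Sum>j\<in>I. \<mu> i * \<mu> j * of_bool (z i = z j))"
    unfolding Z_def by (rule sum.image_gen[OF I, symmetric])
  also have "\<dots> \<le> (\<Sum>i\<in>I. \<Sum>j\<in>I. \<mu> i * \<mu> j * of_bool (\<bar>\<phi> i - \<phi> j\<bar> \<le> 1 / N))"
  proof (intro sum_mono mult_left_mono)
    fix i j
    show "of_bool (z i = z j) \<le> (of_bool (\<bar>\<phi> i - \<phi> j\<bar> \<le> 1 / N) :: real)"
    proof (cases "z i = z j")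
      case True
      then have "\<bar>\<phi> i * N - \<phi> j * N\<bar> \<le> 1" unfolding z_def by linarith
      then have "\<bar>\<phi> i - \<phi> j\<bar> * N \<le> 1" using N by (simp add: abs_mult flip: left_diff_distrib)
      then have "\<bar>\<phi> i - \<phi> j\<bar> \<le> 1 / N" using N by (simp add: field_simps)
      then show ?thesis by simp
    qed simp
  qed (use \<mu> in auto)
  also have "\<dots> \<le> C / N" by (rule near)
  finally have "1 \<le> card Z * (C / N)" by (simp add: mult_left_mono)
  then show ?thesis using N by (simp add: Z_def z_def field_simps)
qed

text \<open>A null compact set has an open neighbourhood \<open>W\<close> of measure below
  \<open>c\<close>, and \<open>W\<close> contains a whole \<open>e\<close>-neighbourhood of the set.
  Once cells are shorter than \<open>e\<close>, every cell that meets the set lies in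
  \<open>W\<close>, and together they have measure at least \<open>c\<close>.\<close>

lemma emeasure_pos_of_many_cells:
  fixes S :: "real set"
  assumes S: "compact S" and c: "0 < c"
    and Z: "\<And>n::nat. \<exists>Z. finite Z \<and> Z \<subseteq> (\<lambda>y. \<lfloor>y * 2 ^ n\<rfloor>) ` S \<and> c * 2 ^ n \<le> real (card Z)"
  shows "0 < emeasure lebesgue S"
proof (rule ccontr)
  assume "\<not> 0 < emeasure lebesgue S"
  then have "emeasure lborel S = 0" using S by (simp add: emeasure_completion borel_compact)
  moreover have "S \<in> sets lborel" using S by (simp add: borel_compact)
  ultimately obtain W where W: "open W" "S \<subseteq> W" "emeasure lborel (W - S) < ennreal c"
    using outer_regular_lborel[of S c] c by auto
  have "emeasure lborel W \<le> emeasure lborel (W - S) + emeasure lborel S"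
    using W S by (intro order_trans[OF emeasure_mono emeasure_subadditive]) (auto simp: borel_compact borel_open)
  then have Wc: "emeasure lborel W < ennreal c" using W(3) \<open>emeasure lborel S = 0\<close> by simp
  obtain e where e: "0 < e" "(\<Union>y\<in>S. ball y e) \<subseteq> W"
    using compact_subset_open_imp_ball_epsilon_subset[OF S W(1,2)] .
  obtain n where n: "(1/2::real) ^ n < e" using real_arch_pow_inv[of e "1/2"] e by auto
  obtain Z where Z: "finite Z" "Z \<subseteq> (\<lambda>y. \<lfloor>y * 2 ^ n\<rfloor>) ` S" "c * 2 ^ n \<le> real (card Z)"
    using assms(3)[of n] by blast
  define cell where "cell = (\<lambda>k::int. {real_of_int k / 2 ^ n..<(real_of_int k + 1) / 2 ^ n})"
  have cellE: "y \<in> cell k \<longleftrightarrow> \<lfloor>y * 2 ^ n\<rfloor> = k" for y k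
    by (auto simp: cell_def floor_eq_iff field_simps)
  have "cell k \<subseteq> W" if "k \<in> Z" for k
  proof
    fix y assume y: "y \<in> cell k"
    obtain x where x: "x \<in> S" "\<lfloor>x * 2 ^ n\<rfloor> = k" using subsetD[OF Z(2) \<open>k \<in> Z\<close>] by auto
    have "\<bar>x * 2 ^ n - y * 2 ^ n\<bar> < 1" using y x(2) unfolding cellE by linarith
    then have "\<bar>x - y\<bar> * 2 ^ n < 1" by (simp add: abs_mult flip: left_diff_distrib)
    then have "\<bar>x - y\<bar> < (1/2) ^ n" by (simp add: field_simps power_divide)
    then have "y \<in> ball x e" using n by (simp add: dist_real_def)
    then show "y \<in> W" using e(2) x(1) by blast
  qed
  then have sub: "(\<Union>k\<in>Z. cell k) \<subseteq> W" by blast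
  have "ennreal c \<le> ennreal (real (card Z) * (1 / 2 ^ n))"
    using Z(3) by (intro ennreal_leI) (simp add: field_simps)
  also have "\<dots> = (\<Sum>k\<in>Z. ennreal (1 / 2 ^ n))"
    by (subst sum_ennreal) auto
  also have "\<dots> = (\<Sum>k\<in>Z. emeasure lborel (cell k))"
    by (intro sum.cong refl) (simp add: cell_def divide_right_mono flip: diff_divide_distrib)
  also have "\<dots> = emeasure lborel (\<Union>k\<in>Z. cell k)"
  proof (rule sum_emeasure)
    show "cell ` Z \<subseteq> sets lborel" by (auto simp: cell_def)
    show "disjoint_family_on cell Z" unfolding disjoint_family_on_def by (auto simp: cellE)
  qed (use Z(1) in simp)
  also have "\<dots> \<le> emeasure lborel W" using sub W(1) by (intro emeasure_mono) auto
  finally show False using Wc by simp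
qed

section \<open>Images of product sets\<close>

text \<open>At a fixed \<open>t\<close> the term \<open>\<tau> t\<close> is only a translation, so
  it cancels in all differences and \<open>\<tau>\<close> may be arbitrary.\<close>

theorem emeasure_pos_of_frostman:
  fixes T U V S :: "real set" and \<tau> \<alpha> \<beta> :: "real \<Rightarrow> real"
  assumes FT: "frostman Ka a T" "0 < a" "bounded T"
    and FU: "frostman Kb b U" "0 < b" "bounded U"
    and FV: "frostman Kc c V" "0 < c"
    and sum: "2 < a + b + c" and \<kappa>: "1 \<le> \<bar>\<kappa>\<bar>"
    and m: "0 < m" "m \<le> 1" "\<And>u. u \<in> U \<Longrightarrow> m \<le> \<bar>\<beta> u\<bar>"
    and S: "compact S"
      "\<And>t u v. t \<in> T \<Longrightarrow> u \<in> U \<Longrightarrow> v \<in> V \<Longrightarrow> \<tau> t + (\<kappa> * t * u + (\<alpha> u + \<beta> u * v)) \<in> S"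
  shows "0 < emeasure lebesgue S"
proof -
  obtain M where M: "1 \<le> M" "\<And>t. t \<in> T \<Longrightarrow> \<bar>t\<bar> \<le> M" "\<And>u. u \<in> U \<Longrightarrow> \<bar>u\<bar> \<le> M"
  proof -
    obtain M1 M2 where "\<forall>t\<in>T. \<bar>t\<bar> \<le> M1" "\<forall>u\<in>U. \<bar>u\<bar> \<le> M2"
      using FT(3) FU(3) by (auto simp: bounded_iff)
    then show ?thesis using that[of "max 1 (max M1 M2)"] by fastforce
  qed
  \<comment> \<open>\<open>h\<close> meets the frequency condition for all points of
    \<open>U\<close>. The choice of \<open>l\<close> makes \<open>L = l * R\<close> large enough for
    every window and for the block itself. \<open>\<theta>\<close> is the ratio of consecutive block
    bounds, below \<open>1\<close> because \<open>a + b + c > 2\<close>.\<close>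
  define h where "h = 1 / (2 * M)"
  define l where "l = 2 * (\<bar>\<kappa>\<bar> * M + 1)"
  define \<theta> :: real where "\<theta> = 2 powr (2 - a - b - c)"
  define C0 where "C0 = 2 * h * Ka * (9 * l) * (9 * l) / h\<^sup>2 * ((4 * Kb + 1) * (4 * Kc + 1) * m powr - c)"
  define C where "C = 4 * (1 + C0 / (1 - \<theta>))"
  have h: "0 < h" "2 * h \<le> 1" using M(1) by (auto simp: h_def)
  have hU: "h * \<bar>u\<bar> \<le> 1" if "u \<in> U" for u using M(1) M(3)[OF that] by (simp add: h_def field_simps)
  have l: "2 \<le> l" using M(1) by (simp add: l_def)
  have \<theta>: "0 < \<theta>" "\<theta> < 1"
  proof -
    have "2 powr (2 - a - b - c) < 2 powr (0::real)" using sum by (intro powr_less_mono) auto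
    then show "0 < \<theta>" "\<theta> < 1" by (auto simp: \<theta>_def)
  qed
  have K: "0 \<le> Ka" "0 \<le> Kb" "0 \<le> Kc"
    using FT(1) FU(1) FV(1) frostman_weights_const_nonneg unfolding frostman_def by blast+
  have C0: "0 \<le> C0" using K h l by (simp add: C0_def)
  have C: "0 < C" using C0 \<theta> by (simp add: C_def add_pos_nonneg)
  have "\<exists>Z. finite Z \<and> Z \<subseteq> (\<lambda>y. \<lfloor>y * 2 ^ n\<rfloor>) ` S \<and> 1 / C * 2 ^ n \<le> real (card Z)" for n :: nat
  proof -
    obtain P p where P: "P \<subseteq> T" "frostman_weights Ka a n P p" using FT(1) unfolding frostman_def by blast
    obtain Q q where Q: "Q \<subseteq> U" "frostman_weights Kb b n Q q" using FU(1) unfolding frostman_def by blast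
    obtain W s where W: "W \<subseteq> V" "frostman_weights Kc c n W s" using FV(1) unfolding frostman_def by blast
    note DP = frostman_weightsD[OF P(2)] and DQ = frostman_weightsD[OF Q(2)] and DW = frostman_weightsD[OF W(2)]
    define I where "I = Q \<times> W"
    define \<mu> where "\<mu> = (\<lambda>(u, v). q u * s v)"
    define w where "w = (\<lambda>(u, v). \<alpha> u + \<beta> u * v)"
    define \<phi> where "\<phi> = (\<lambda>t i. \<kappa> * t * fst i + w i)"
    define G where "G = (\<lambda>t \<rho>. (cmod (\<Sum>i\<in>I. \<mu> i * cis (\<rho> * \<phi> t i)))\<^sup>2)"
    define E where "E = (\<lambda>\<rho>. \<Sum>t\<in>P. p t * G t \<rho>)"
    define near where "near = (\<lambda>t. \<Sum>i\<in>I. \<Sum>j\<in>I. \<mu> i * \<mu> j * of_bool (\<bar>\<phi> t i - \<phi> t j\<bar> \<le> 1 / 2 ^ n))"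
    have I: "finite I" using DQ(1) DW(1) by (simp add: I_def)
    have \<mu>: "0 \<le> \<mu> i" if "i \<in> I" for i using that DQ(2) DW(2) by (auto simp: I_def \<mu>_def)
    have \<mu>1: "sum \<mu> I = 1"
    proof -
      have "sum \<mu> I = sum q Q * sum s W"
        unfolding I_def \<mu>_def sum_product sum.cartesian_product ..
      then show ?thesis using DQ(3) DW(3) by simp
    qed
    have contG: "continuous_on X (G t)" for X t unfolding G_def by (intro continuous_intros)
    have contE: "continuous_on X E" for X unfolding E_def by (intro continuous_intros contG)
    have E1: "E \<rho> \<le> 1" for \<rho>
    proof -
      have "G t \<rho> \<le> 1" for t
      proof -
        have "cmod (\<Sum>i\<in>I. \<mu> i * cis (\<rho> * \<phi> t i)) \<le> (\<Sum>i\<in>I. \<mu> i)"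
          using \<mu> by (intro order_trans[OF norm_sum] sum_mono) (auto simp: norm_mult)
        then show ?thesis by (simp add: G_def \<mu>1 power_le_one)
      qed
      then have "E \<rho> \<le> (\<Sum>t\<in>P. p t * 1)"
        unfolding E_def using DP(2) by (intro sum_mono mult_left_mono) auto
      then show ?thesis using DP(3) by simp
    qed
    have block: "integral {2 ^ k..2 * 2 ^ k} E \<le> C0 * \<theta> ^ k" if k: "k < n" for k
    proof -
      define R :: real where "R = 2 ^ k"
      have R: "1 \<le> R" "R \<le> 2 ^ n" using k by (auto simp: R_def intro: power_increasing)
      have lR: "2 * R \<le> l * R" using l R by (intro mult_right_mono) auto
      have "integral {R..2 * R} E \<le> 2 * h * (Ka * R powr - a) * (9 * (l * R)) * (9 * (l * R)) / h\<^sup>2 *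
        (\<Sum>i\<in>I. \<Sum>j\<in>I. \<mu> i * \<mu> j * exp (- (l * R * (fst i - fst j))\<^sup>2 / 2) * exp (- (l * R * (w i - w j))\<^sup>2 / 2))"
        unfolding E_def G_def \<phi>_def
      proof (rule dyadic_block_bound[OF P(2) I \<mu> h])
        show "h * \<bar>fst i\<bar> \<le> 1" if "i \<in> I" for i using that Q(1) hU by (auto simp: I_def)
        show "2 * R * \<bar>\<kappa> * t\<bar> + h \<le> l * R" if "t \<in> P" for t
        proof -
          have "\<bar>\<kappa> * t\<bar> \<le> \<bar>\<kappa>\<bar> * M" using M(2) that P(1) by (auto simp: abs_mult intro!: mult_left_mono)
          then have "2 * R * \<bar>\<kappa> * t\<bar> \<le> 2 * R * (\<bar>\<kappa>\<bar> * M)" using R by (intro mult_left_mono) auto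
          moreover have "l * R = 2 * R * (\<bar>\<kappa>\<bar> * M) + 2 * R" by (simp add: l_def algebra_simps)
          ultimately show ?thesis using h R by linarith
        qed
      qed (use \<kappa> R lR in auto)
      also have "\<dots> \<le> 2 * h * (Ka * R powr - a) * (9 * (l * R)) * (9 * (l * R)) / h\<^sup>2 *
        (((4 * Kb + 1) * R powr - b) * ((4 * Kc + 1) * (m * R) powr - c))"
        unfolding I_def
      proof (rule mult_left_mono)
        show "(\<Sum>i\<in>Q \<times> W. \<Sum>j\<in>Q \<times> W. \<mu> i * \<mu> j * exp (- (l * R * (fst i - fst j))\<^sup>2 / 2) * exp (- (l * R * (w i - w j))\<^sup>2 / 2))
          \<le> ((4 * Kb + 1) * R powr - b) * ((4 * Kc + 1) * (m * R) powr - c)"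
          using m Q(1) R lR by (intro gaussian_energy_le[OF Q(2) FU(2) W(2) FV(2) _ _ _ _ _ _ \<mu>_def w_def]) auto
        show "0 \<le> 2 * h * (Ka * R powr - a) * (9 * (l * R)) * (9 * (l * R)) / h\<^sup>2" using h K l R by simp
      qed
      \<comment> \<open>The three negative powers come from the directions and from the two factors
        of the energy; \<open>R\<^sup>2\<close> comes from the two factors \<open>L\<close>.\<close>
      also have "\<dots> = C0 * (R powr - a * R powr - b * R powr - c * R\<^sup>2)"
        using m R by (simp add: C0_def powr_mult power2_eq_square)
      also have "R powr - a * R powr - b * R powr - c * R\<^sup>2 = R powr (2 - a - b - c)"
      proof -
        have "R\<^sup>2 = R powr 2" using R by (simp add: powr_numeral)
        moreover have "2 - a - b - c = - a + - b + - c + 2" by simp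
        ultimately show ?thesis by (simp only: powr_add)
      qed
      also have "\<dots> = \<theta> ^ k"
      proof -
        have "R = 2 powr k" by (simp add: R_def powr_realpow)
        then have "R powr (2 - a - b - c) = \<theta> powr k" by (simp add: \<theta>_def powr_powr mult.commute)
        then show ?thesis using \<theta> by (simp add: powr_realpow)
      qed
      finally show ?thesis by (simp add: R_def)
    qed
    have "(\<Sum>t\<in>P. p t * near t) \<le> (\<Sum>t\<in>P. p t * (4 / 2 ^ n * integral {0..2 ^ n} (G t)))"
      unfolding near_def G_def using DP(2) I \<mu>
      by (intro sum_mono mult_left_mono near_pairs_le_integral) auto
    also have "\<dots> = 4 / 2 ^ n * (\<Sum>t\<in>P. p t * integral {0..2 ^ n} (G t))" by (simp add: sum_distrib_left mult_ac)
    also have "(\<Sum>t\<in>P. p t * integral {0..2 ^ n} (G t)) = integral {0..2 ^ n} E"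
      unfolding E_def
      by (intro integral_unique[symmetric] has_integral_sum DP(1) has_integral_mult_right
          integrable_integral integrable_continuous_interval contG)
    also have "4 / 2 ^ n * integral {0..2 ^ n} E \<le> 4 / 2 ^ n * (1 + C0 / (1 - \<theta>))"
      by (intro mult_left_mono integral_le_dyadic_blocks contE E1 block C0 \<theta>) auto
    also have "\<dots> = C / 2 ^ n" by (simp add: C_def)
    finally have avg: "(\<Sum>t\<in>P. p t * near t) \<le> C / 2 ^ n" .
    \<comment> \<open>Some direction does no worse than the weighted average; it depends on
      \<open>n\<close>.\<close>
    obtain t where t: "t \<in> P" "near t \<le> C / 2 ^ n"
    proof (rule ccontr)
      assume "\<not> thesis"
      then have big: "C / 2 ^ n < near t" if "t \<in> P" for t using that \<open>\<And>t. t \<in> P \<Longrightarrow> near t \<le> C / 2 ^ n \<Longrightarrow> thesis\<close> by force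
      obtain t0 where t0: "t0 \<in> P" "p t0 \<noteq> 0"
        using DP(3) by (metis sum.neutral zero_neq_one)
      have "C / 2 ^ n = (\<Sum>t\<in>P. p t * (C / 2 ^ n))" using DP(3) by (simp flip: sum_distrib_right sum_divide_distrib)
      also have "\<dots> < (\<Sum>t\<in>P. p t * near t)"
      proof (rule sum_strict_mono_ex1[OF DP(1)])
        show "\<forall>t\<in>P. p t * (C / 2 ^ n) \<le> p t * near t" 
          using DP(2) by (intro ballI mult_left_mono less_imp_le[OF big])
        have "0 < p t0" using t0 DP(2)[of t0] by simp
        then show "\<exists>t\<in>P. p t * (C / 2 ^ n) < p t * near t" using t0(1) big[of t0] by (intro bexI[of _ t0] mult_strict_left_mono) auto
      qed
      finally show False using avg by simp
    qed
    \<comment> \<open>The translation by \<open>\<tau> t\<close> enters only now, and the bound on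
      near pairs is unaffected by it.\<close>
    define Z where "Z = (\<lambda>i. \<lfloor>(\<tau> t + \<phi> t i) * 2 ^ n\<rfloor>) ` I"
    have "2 ^ n \<le> C * card Z"
      unfolding Z_def
      by (rule card_cells_lower_bound[OF I \<mu> \<mu>1]) (use t(2) in \<open>simp_all add: near_def\<close>)
    then have "1 / C * 2 ^ n \<le> real (card Z)" using C by (simp add: field_simps)
    moreover have "finite Z" using I by (simp add: Z_def)
    moreover have "Z \<subseteq> (\<lambda>y. \<lfloor>y * 2 ^ n\<rfloor>) ` S"
      using S(2) t(1) P(1) Q(1) W(1) by (fastforce simp: Z_def I_def \<phi>_def w_def)
    ultimately show ?thesis by blast
  qed
  then show ?thesis using C by (intro emeasure_pos_of_many_cells[OF S(1), of "1 / C"]) auto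
qed

text \<open>As no summand exceeds \<open>1\<close>, each is at least the excess \<open>4 * e\<close>
  of the sum over \<open>2\<close>. Lowering all three by \<open>e\<close> thus keeps them positive
  and leaves the sum at \<open>2 + e\<close>.\<close>

lemma exponents_below_dims:
  fixes x y z :: ereal
  assumes "x \<le> 1" "y \<le> 1" "z \<le> 1" "2 < x + y + z" "0 \<le> x" "0 \<le> y" "0 \<le> z"
  obtains a b c where "0 < a" "ereal a < x" "0 < b" "ereal b < y" "0 < c" "ereal c < z" "2 < a + b + c"
proof -
  obtain x' y' z' where r: "x = ereal x'" "y = ereal y'" "z = ereal z'"
    using assms by (cases x; cases y; cases z) auto
  define e where "e = (x' + y' + z' - 2) / 4"
  have "x' \<le> 1" "y' \<le> 1" "z' \<le> 1" "2 < x' + y' + z'"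
    using assms unfolding r by (auto simp: one_ereal_def numeral_eq_ereal)
  then show ?thesis
    by (intro that[of "x' - e" "y' - e" "z' - e"]) (auto simp: r e_def field_simps)
qed

lemma hausdorff_dim_nonneg: "0 \<le> hausdorff_dim A"
  unfolding hausdorff_dim_def by (intro INF_greatest) auto

lemma compact_image3:
  fixes f :: "real \<times> real \<times> real \<Rightarrow> real"
  assumes "compact A" "compact B" "compact C" "continuous_on UNIV f"
  shows "compact {f (x, y, z) | x y z. x \<in> A \<and> y \<in> B \<and> z \<in> C}"
proof -
  have "{f (x, y, z) | x y z. x \<in> A \<and> y \<in> B \<and> z \<in> C} = f ` (A \<times> B \<times> C)" by force
  then show ?thesis
    using assms by (auto intro!: compact_continuous_image compact_Times intro: continuous_on_subset)
qed

theorem corollary1p3: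
  fixes A B C :: "real set"
  assumes "compact A" and "compact B" and "compact C"
    and "hausdorff_dim A + hausdorff_dim B + hausdorff_dim C > 2"
  shows "emeasure lebesgue {(x - y)\<^sup>2 + z | x y z. x \<in> A \<and> y \<in> B \<and> z \<in> C} > 0 \<and>
    emeasure lebesgue {x * y + z | x y z. x \<in> A \<and> y \<in> B \<and> z \<in> C} > 0 \<and>
    emeasure lebesgue {x * (y + z) | x y z. x \<in> A \<and> y \<in> B \<and> z \<in> C} > 0"
proof (intro conjI)
  have bd: "bounded A" "bounded B" "bounded C" using assms by (auto intro: compact_imp_bounded)
  obtain a b c where abc: "0 < a" "ereal a < hausdorff_dim A" "0 < b" "ereal b < hausdorff_dim B"
    "0 < c" "ereal c < hausdorff_dim C" "2 < a + b + c"
    using exponents_below_dims[OF hausdorff_dim_le_1[OF bd(1)] hausdorff_dim_le_1[OF bd(2)]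
        hausdorff_dim_le_1[OF bd(3)] assms(4) hausdorff_dim_nonneg hausdorff_dim_nonneg hausdorff_dim_nonneg] .
  obtain Ka where FA: "frostman Ka a A" using frostman_exists_below_dim[OF bd(1) abc(1,2)] .
  obtain Kb where FB: "frostman Kb b B" using frostman_exists_below_dim[OF bd(2) abc(3,4)] .
  obtain Kc where FC: "frostman Kc c C" using frostman_exists_below_dim[OF bd(3) abc(5,6)] .
  \<comment> \<open>Expanding the square isolates the mixed term \<open>-2 * x * y\<close>; the
    remaining squares go into \<open>\<tau>\<close> and \<open>\<alpha>\<close>.\<close>
  show "0 < emeasure lebesgue {(x - y)\<^sup>2 + z | x y z. x \<in> A \<and> y \<in> B \<and> z \<in> C}"
  proof (rule emeasure_pos_of_frostman[OF FA abc(1) bd(1) FB abc(3) bd(2) FC abc(5,7),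
        where \<kappa> = "-2" and m = 1 and \<tau> = "\<lambda>x. x\<^sup>2" and \<alpha> = "\<lambda>y. y\<^sup>2" and \<beta> = "\<lambda>_. 1"])
    show "compact {(x - y)\<^sup>2 + z | x y z. x \<in> A \<and> y \<in> B \<and> z \<in> C}"
      using compact_image3[OF assms(1-3), of "\<lambda>(x, y, z). (x - y)\<^sup>2 + z"]
      by (simp add: case_prod_beta continuous_intros)
    fix x y z assume "x \<in> A" "y \<in> B" "z \<in> C"
    moreover have "x\<^sup>2 + (- 2 * x * y + (y\<^sup>2 + 1 * z)) = (x - y)\<^sup>2 + z" by (simp add: power2_diff)
    ultimately show "x\<^sup>2 + (- 2 * x * y + (y\<^sup>2 + 1 * z)) \<in> {(x - y)\<^sup>2 + z | x y z. x \<in> A \<and> y \<in> B \<and> z \<in> C}"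
      by blast
  qed auto
  show "0 < emeasure lebesgue {x * y + z | x y z. x \<in> A \<and> y \<in> B \<and> z \<in> C}"
  proof (rule emeasure_pos_of_frostman[OF FA abc(1) bd(1) FB abc(3) bd(2) FC abc(5,7),
        where \<kappa> = 1 and m = 1 and \<tau> = "\<lambda>_. 0" and \<alpha> = "\<lambda>_. 0" and \<beta> = "\<lambda>_. 1"])
    show "compact {x * y + z | x y z. x \<in> A \<and> y \<in> B \<and> z \<in> C}"
      using compact_image3[OF assms(1-3), of "\<lambda>(x, y, z). x * y + z"]
      by (simp add: case_prod_beta continuous_intros)
  qed auto
  show "0 < emeasure lebesgue {x * (y + z) | x y z. x \<in> A \<and> y \<in> B \<and> z \<in> C}"
  proof -
    obtain m where m: "0 < m" "m \<le> 1" "frostman (2 * Ka) a {x \<in> A. m \<le> \<bar>x\<bar>}"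
      using frostman_away_from_0[OF FA abc(1)] .
    have bd': "bounded {x \<in> A. m \<le> \<bar>x\<bar>}" using bd(1) by (rule bounded_subset) auto
    have sum': "2 < b + a + c" using abc(7) by simp
    show ?thesis
    \<comment> \<open>The roles of the first two sets are exchanged: \<open>y\<close> is the
      direction, and \<open>x\<close> is both the first coordinate and the slope of
      \<open>z\<close>, which is why \<open>A\<close> was cut off near \<open>0\<close>. Shrinking
      \<open>A\<close> is harmless because the image of the smaller set still lies in the full
      image.\<close>
    proof (rule emeasure_pos_of_frostman[OF FB abc(3) bd(2) m(3) abc(1) bd' FC abc(5) sum',
          where \<kappa> = 1 and m = m and \<tau> = "\<lambda>_. 0" and \<alpha> = "\<lambda>_. 0" and \<beta> = "\<lambda>x. x"])
      show "compact {x * (y + z) | x y z. x \<in> A \<and> y \<in> B \<and> z \<in> C}"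
        using compact_image3[OF assms(1-3), of "\<lambda>(x, y, z). x * (y + z)"]
        by (simp add: case_prod_beta continuous_intros)
      fix y x z assume "y \<in> B" "x \<in> {x \<in> A. m \<le> \<bar>x\<bar>}" "z \<in> C"
      moreover have "0 + (1 * y * x + (0 + x * z)) = x * (y + z)" by (simp add: algebra_simps)
      ultimately show "0 + (1 * y * x + (0 + x * z)) \<in> {x * (y + z) | x y z. x \<in> A \<and> y \<in> B \<and> z \<in> C}"
        by blast
    qed (use m in auto)
  qed
qed

end
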